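(* Let $(X,f)$ be a topological dynamical system and let $L\ge 1$ be an integer. Assume that there exists a subsystem $(Y,f^L)$ of $(X,f^L)$ such that (1) $(Y,f^L)$ satisfies the shadowing property and $h_{\mathrm{top}}(f^L,Y)>0$; (2) $X=\bigcup_{i=0}^{L-1}f^i(Y)$. Then for any non-trivial weight $\vartheta\in\ell^\infty(\mathbb N)$, \[ h_{\mathrm{top}}(f,\mathcal N_\vartheta(f,X))=h_{\mathrm{top}}(f,X)=\frac1L h_{\mathrm{top}}(f^L,Y)>0 . \] In particular, $(X,f)$ is Bohr chaotic.
   Context: A topological dynamical system $(X,f)$ consists of a compact metric space $(X,d)$ and a continuous map $f:X\to X$. A subsystem $(Y,f^L)$ of $(X,f^L)$ is a nonempty compact set $Y\subset X$ with $f^L(Y)\subset Y$. Shadowing property of a system $(Z,g)$: for every $\varepsilon>0$ there is $\delta>0$ such that every sequence $(x_n)_{n\ge0}$ in $Z$ with $d(g(x_i),x_{i+1})<\delta$ for all $i\ge0$ is $\varepsilon$-traced by some $x\in Z$, i.e. $d(g^i(x),x_i)<\varepsilon$ for all $i\ge 0$. A bounded real sequence $\vartheta=(\vartheta_n)_{n\ge 0}$ is a non-trivial weight if $\limsup_{N\to\infty}\frac1N\sum_{n=0}^{N-1}|\vartheta_n|>0$. $\mathcal N_\vartheta(f,X)$ is the set of $x\in X$ for which there is a continuous $\varphi:X\to\mathbb R$ with $\limsup_{N\to\infty}\frac1N\left|\sum_{n=0}^{N-1}\vartheta_n\varphi(f^nx)\right|>0$. $(X,f)$ is Bohr chaotic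 if $\mathcal N_\vartheta(f,X)\neq\emptyset$ for every non-trivial weight $\vartheta$. Bowen topological entropy of a subset $E\subset X$ (for a map $f$): let $B_u(f;x,r)=\{z\in X: d(f^ix,f^iz)<r,\ 0\le i\le u-1\}$. For $t\ge0$ let $C(E;t,n,r,f)$ be the infimum of $\sum e^{-tu}$ over all finite or countable covers of $E$ by sets $B_u(f;x,r)$ with $u\ge n$; let $C(E;t,r,f)=\lim_{n\to\infty}C(E;t,n,r,f)$, $h_{\mathrm{top}}(E;r,f)=\inf\{t:C(E;t,r,f)=0\}$ and $h_{\mathrm{top}}(f,E)=\lim_{r\to0}h_{\mathrm{top}}(E;r,f)$. For a subsystem this equals the classical topological entropy. *)

theory Defs
  imports "HOL-Analysis.Analysis"
begin

text \<open>A system is given by a carrier set in a metric space type together with a self-map of the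
  type of which only the restriction to the carrier matters. The iterates
  \<open>f ^^ n\<close> are those of the function on the type; they agree on the carrier with the
  iterates of the restriction.\<close>

definition topological_dynamical_system :: "'a::metric_space set \<Rightarrow> ('a \<Rightarrow> 'a) \<Rightarrow> bool" where
  "topological_dynamical_system X f \<longleftrightarrow> compact X \<and> continuous_on X f \<and> f ` X \<subseteq> X"

definition subsystem :: "'a::metric_space set \<Rightarrow> ('a \<Rightarrow> 'a) \<Rightarrow> 'a set \<Rightarrow> bool" where
  "subsystem X g Y \<longleftrightarrow> Y \<noteq> {} \<and> compact Y \<and> Y \<subseteq> X \<and> g ` Y \<subseteq> Y"

definition shadowing_property :: "'a::metric_space set \<Rightarrow> ('a \<Rightarrow> 'a) \<Rightarrow> bool" where
  "shadowing_property Z g \<longleftrightarrow>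
     (\<forall>\<epsilon>>0. \<exists>\<delta>>0. \<forall>x :: nat \<Rightarrow> 'a.
        (\<forall>i. x i \<in> Z) \<and> (\<forall>i. dist (g (x i)) (x (Suc i)) < \<delta>) \<longrightarrow>
        (\<exists>z\<in>Z. \<forall>i. dist ((g ^^ i) z) (x i) < \<epsilon>))"

definition nontrivial_weight :: "(nat \<Rightarrow> real) \<Rightarrow> bool" where
  "nontrivial_weight \<theta> \<longleftrightarrow>
     bounded (range \<theta>) \<and> limsup (\<lambda>N. ereal (1 / real N * (\<Sum>n<N. \<bar>\<theta> n\<bar>))) > 0"

definition correlated_points ::
  "(nat \<Rightarrow> real) \<Rightarrow> ('a::metric_space \<Rightarrow> 'a) \<Rightarrow> 'a set \<Rightarrow> 'a set" where
  "correlated_points \<theta> f X =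
     {x \<in> X. \<exists>\<phi> :: 'a \<Rightarrow> real. continuous_on X \<phi> \<and>
        limsup (\<lambda>N. ereal (1 / real N * \<bar>\<Sum>n<N. \<theta> n * \<phi> ((f ^^ n) x)\<bar>)) > 0}"

definition bohr_chaotic :: "'a::metric_space set \<Rightarrow> ('a \<Rightarrow> 'a) \<Rightarrow> bool" where
  "bohr_chaotic X f \<longleftrightarrow> (\<forall>\<theta>. nontrivial_weight \<theta> \<longrightarrow> correlated_points \<theta> f X \<noteq> {})"

definition bowen_ball ::
  "'a::metric_space set \<Rightarrow> ('a \<Rightarrow> 'a) \<Rightarrow> nat \<Rightarrow> 'a \<Rightarrow> real \<Rightarrow> 'a set" where
  "bowen_ball X f u x r = {z \<in> X. \<forall>i<u. dist ((f ^^ i) x) ((f ^^ i) z) < r}"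

text \<open>A cover by Bowen balls is recorded by the countable (possibly finite) set of pairs
  (centre, length) that occur in it. Listing a ball repeatedly only increases the sum, so
  sets of pairs and indexed families give the same infimum.\<close>

definition bowen_covers ::
  "'a::metric_space set \<Rightarrow> ('a \<Rightarrow> 'a) \<Rightarrow> 'a set \<Rightarrow> nat \<Rightarrow> real \<Rightarrow> ('a \<times> nat) set set" where
  "bowen_covers X f E n r =
     {\<C>. countable \<C> \<and> (\<forall>(x, u) \<in> \<C>. x \<in> X \<and> n \<le> u) \<and>
         E \<subseteq> (\<Union>(x, u) \<in> \<C>. bowen_ball X f u x r)}"

definition bowen_sum_at ::
  "'a::metric_space set \<Rightarrow> ('a \<Rightarrow> 'a) \<Rightarrow> 'a set \<Rightarrow> real \<Rightarrow> nat \<Rightarrow> real \<Rightarrow> ennreal" where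
  "bowen_sum_at X f E t n r =
     (INF \<C> \<in> bowen_covers X f E n r. \<Sum>\<^sub>\<infinity>(x, u) \<in> \<C>. ennreal (exp (- t * real u)))"

definition bowen_sum ::
  "'a::metric_space set \<Rightarrow> ('a \<Rightarrow> 'a) \<Rightarrow> 'a set \<Rightarrow> real \<Rightarrow> real \<Rightarrow> ennreal" where
  "bowen_sum X f E t r = lim (\<lambda>n. bowen_sum_at X f E t n r)"

definition bowen_entropy_at ::
  "'a::metric_space set \<Rightarrow> ('a \<Rightarrow> 'a) \<Rightarrow> 'a set \<Rightarrow> real \<Rightarrow> ereal" where
  "bowen_entropy_at X f E r = Inf {ereal t | t. 0 \<le> t \<and> bowen_sum X f E t r = 0}"

definition bowen_entropy ::
  "'a::metric_space set \<Rightarrow> ('a \<Rightarrow> 'a) \<Rightarrow> 'a set \<Rightarrow> ereal" where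
  "bowen_entropy X f E = Lim (at_right 0) (\<lambda>r. bowen_entropy_at X f E r)"

text \<open>Both limits in these definitions exist, by monotonicity.\<close>

lemma bowen_sum_at_tendsto:
  "(\<lambda>n. bowen_sum_at X f E t n r) \<longlonglongrightarrow> bowen_sum X f E t r"
  and bowen_sum_eq_SUP: "bowen_sum X f E t r = (SUP n. bowen_sum_at X f E t n r)"
proof -
  have "incseq (\<lambda>n. bowen_sum_at X f E t n r)"
    unfolding bowen_sum_at_def
    by (intro monoI INF_superset_mono) (fastforce simp: bowen_covers_def)+
  then have *: "(\<lambda>n. bowen_sum_at X f E t n r) \<longlonglongrightarrow> (SUP n. bowen_sum_at X f E t n r)"
    by (rule LIMSEQ_SUP)
  then show "bowen_sum X f E t r = (SUP n. bowen_sum_at X f E t n r)"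
    unfolding bowen_sum_def by (rule limI)
  with * show "(\<lambda>n. bowen_sum_at X f E t n r) \<longlonglongrightarrow> bowen_sum X f E t r"
    by simp
qed

lemma bowen_entropy_at_antimono:
  assumes "r \<le> s"
  shows "bowen_entropy_at X f E s \<le> bowen_entropy_at X f E r"
proof -
  have ball: "bowen_ball X f u x r \<subseteq> bowen_ball X f u x s" for u x
    using assms by (fastforce simp: bowen_ball_def)
  have "bowen_covers X f E n r \<subseteq> bowen_covers X f E n s" for n
  proof
    fix \<C> assume C: "\<C> \<in> bowen_covers X f E n r"
    have "(\<Union>(x, u) \<in> \<C>. bowen_ball X f u x r) \<subseteq> (\<Union>(x, u) \<in> \<C>. bowen_ball X f u x s)"
      using ball by fast
    with C show "\<C> \<in> bowen_covers X f E n s"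
      unfolding bowen_covers_def by blast
  qed
  then have "bowen_sum_at X f E t n s \<le> bowen_sum_at X f E t n r" for t n
    unfolding bowen_sum_at_def by (rule INF_superset_mono) simp
  then have "bowen_sum X f E t s \<le> bowen_sum X f E t r" for t
    unfolding bowen_sum_eq_SUP by (intro SUP_mono) auto
  then have "bowen_sum X f E t r = 0 \<Longrightarrow> bowen_sum X f E t s = 0" for t
    by (metis le_zero_eq)
  then show ?thesis
    unfolding bowen_entropy_at_def by (intro Inf_superset_mono) auto
qed

lemma bowen_entropy_at_tendsto:
  "(bowen_entropy_at X f E \<longlongrightarrow> bowen_entropy X f E) (at_right 0)"
  and bowen_entropy_eq_SUP: "bowen_entropy X f E = (SUP r \<in> {0<..}. bowen_entropy_at X f E r)"
proof -
  let ?S = "SUP r \<in> {0<..}. bowen_entropy_at X f E r"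
  have *: "(bowen_entropy_at X f E \<longlongrightarrow> ?S) (at_right 0)"
  proof (rule order_tendstoI)
    fix a assume "a < ?S"
    then obtain s where s: "s > 0" "a < bowen_entropy_at X f E s"
      by (auto simp: less_SUP_iff)
    have "\<forall>\<^sub>F r in at_right 0. r < s"
      using s(1) eventually_at_right by blast
    then show "\<forall>\<^sub>F r in at_right 0. a < bowen_entropy_at X f E r"
      by eventually_elim
        (meson s(2) bowen_entropy_at_antimono less_le_trans less_imp_le)
  next
    fix a assume a: "?S < a"
    have "\<forall>\<^sub>F r in at_right 0. (0::real) < r"
      by (simp add: eventually_at_right_less)
    then show "\<forall>\<^sub>F r in at_right 0. bowen_entropy_at X f E r < a"
      by eventually_elim (meson a SUP_upper greaterThan_iff le_less_trans)
  qed
  then show "bowen_entropy X f E = ?S"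
    unfolding bowen_entropy_def by (intro tendsto_Lim) auto
  with * show "(bowen_entropy_at X f E \<longlongrightarrow> bowen_entropy X f E) (at_right 0)"
    by simp
qed

end

theory Submission
  imports Defs "HOL-Probability.Probability" "HOL-Real_Asymp.Real_Asymp"
begin

text \<open>The upper bounds are soft, so the point is to find enough points correlated with the weight.
  Let \<open>g = f ^^ L\<close>. Positive Bowen entropy of \<open>Y\<close> forces many separated \<open>g\<close>-orbit words that start
  and end in one cell of tiny diameter; concatenating them freely gives pseudo-orbits, which
  shadowing turns into orbits. Only finite precision \<open>\<epsilon>\<close> is available, so a test function
  cannot compare two traced orbits directly. Instead a marker \<open>a b\<close> of two words is chosen that
  does not overlap itself approximately, and the few words that could occur inside a shifted
  copy of it are discarded: then a bump function around the marker sees exactly the places where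
  the marker was inserted. Inserting it at a fixed residue modulo the superblock length, precisely
  where the weight has a fixed sign, makes the weighted average along the orbit equal to the
  average of \<open>\<bar>\<theta>\<bar>\<close> over those places, and almost all positions remain free. The uniform product
  measure on the free positions bounds the Bowen entropy from below.\<close>

section \<open>Bowen entropy\<close>

lemma infsum_ennreal_eq_SUP:
  fixes g :: "'i \<Rightarrow> ennreal"
  shows "infsum g A = (SUP F \<in> {F. finite F \<and> F \<subseteq> A}. sum g F)"
  by (rule nonneg_infsum_complete) simp

lemma sum_le_infsum_ennreal:
  fixes g :: "'i \<Rightarrow> ennreal"
  assumes "finite F" "F \<subseteq> A"
  shows "sum g F \<le> infsum g A"
  unfolding infsum_ennreal_eq_SUP using assms by (intro SUP_upper) auto

lemma infsum_ennreal_mono: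
  fixes g h :: "'i \<Rightarrow> ennreal"
  assumes "\<And>i. i \<in> A \<Longrightarrow> g i \<le> h i"
  shows "infsum g A \<le> infsum h A"
  using assms by (intro infsum_mono nonneg_summable_on_complete) auto

text \<open>The sets \<open>A c\<close> may overlap: a finite subset of the union is split by
  choosing for each element one index \<open>h x\<close>, and every piece is bounded by one inner
  sum.\<close>

lemma infsum_UN_le:
  fixes g :: "'i \<Rightarrow> ennreal"
  shows "infsum g (\<Union>c\<in>I. A c) \<le> (\<Sum>\<^sub>\<infinity>c\<in>I. infsum g (A c))"
  unfolding infsum_ennreal_eq_SUP[of g "\<Union>c\<in>I. A c"]
proof (rule SUP_least, clarify)
  fix F assume F: "finite F" "F \<subseteq> (\<Union>c\<in>I. A c)"
  then obtain h where h: "\<And>x. x \<in> F \<Longrightarrow> h x \<in> I \<and> x \<in> A (h x)"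
    by (metis UN_E subsetD)
  have "sum g F = (\<Sum>c\<in>h ` F. sum g {x \<in> F. h x = c})"
    by (rule sum.image_gen) (rule F)
  also have "\<dots> \<le> (\<Sum>c\<in>h ` F. infsum g (A c))"
    using F h by (intro sum_mono sum_le_infsum_ennreal) (auto, metis)
  also have "\<dots> \<le> (\<Sum>\<^sub>\<infinity>c\<in>I. infsum g (A c))"
    using F h by (intro sum_le_infsum_ennreal) auto
  finally show "sum g F \<le> (\<Sum>\<^sub>\<infinity>c\<in>I. infsum g (A c))" .
qed

lemma infsum_ennreal_nat: "infsum g UNIV = (\<Sum>n. g n)" for g :: "nat \<Rightarrow> ennreal"
  by (metis has_sum_imp_sums has_sum_infsum nonneg_summable_on_complete sums_unique zero_le)

text \<open>Bowen covers are sets of pairs, not sequences, so subadditivity is needed over an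
  arbitrary countable index set. The enumeration may repeat an index; partial unions over its image
  count each index once.\<close>

lemma emeasure_UN_le_infsum:
  assumes "countable I" and A: "\<And>i. i \<in> I \<Longrightarrow> A i \<in> sets M"
  shows "emeasure M (\<Union>i\<in>I. A i) \<le> (\<Sum>\<^sub>\<infinity>i\<in>I. emeasure M (A i))"
proof (cases "I = {}")
  case False
  define B where "B n = (\<Union>i\<in>from_nat_into I ` {..n}. A i)" for n :: nat
  have sub: "from_nat_into I ` {..n} \<subseteq> I" for n
    using False by (auto intro: from_nat_into)
  have "(\<Union>i\<in>I. A i) = (\<Union>n. B n)"
  proof -
    have "I = range (from_nat_into I)"
      using False assms(1) by (simp add: range_from_nat_into)
    then have "(\<Union>i\<in>I. A i) = (\<Union>n. A (from_nat_into I n))"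
      by (metis image_image)
    also have "\<dots> = (\<Union>n. B n)"
      unfolding B_def by blast
    finally show ?thesis .
  qed
  moreover have "(SUP n. emeasure M (B n)) = emeasure M (\<Union>n. B n)"
    using A sub unfolding B_def
    by (intro SUP_emeasure_incseq) (auto simp: incseq_def, fastforce+)
  moreover have "emeasure M (B n) \<le> (\<Sum>\<^sub>\<infinity>i\<in>I. emeasure M (A i))" for n
  proof -
    have "emeasure M (B n) \<le> (\<Sum>i\<in>from_nat_into I ` {..n}. emeasure M (A i))"
      unfolding B_def using A sub by (intro emeasure_subadditive_finite) auto
    also have "\<dots> \<le> (\<Sum>\<^sub>\<infinity>i\<in>I. emeasure M (A i))"
      using sub by (intro sum_le_infsum_ennreal) auto
    finally show ?thesis .
  qed
  ultimately show ?thesis by (metis SUP_least)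
qed simp

section \<open>Null exponents, monotonicity and countable stability\<close>

lemma bowen_sum_eq_0_iff:
  "bowen_sum X f E t r = 0 \<longleftrightarrow>
     (\<forall>n. \<forall>e>0. \<exists>\<C>\<in>bowen_covers X f E n r. (\<Sum>\<^sub>\<infinity>(x, u)\<in>\<C>. ennreal (exp (- t * real u))) < e)"
proof -
  have "bowen_sum X f E t r = 0 \<longleftrightarrow> (\<forall>n. bowen_sum_at X f E t n r = 0)"
    unfolding bowen_sum_eq_SUP bot_ennreal[symmetric] by simp
  also have "\<dots> \<longleftrightarrow> (\<forall>n. \<forall>e>0. bowen_sum_at X f E t n r < e)"
    by (metis gr_zeroI not_less_iff_gr_or_eq)
  finally show ?thesis
    unfolding bowen_sum_at_def INF_less_iff .
qed

lemma bowen_sum_nullI: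
  assumes "\<And>n e. e > 0 \<Longrightarrow> \<exists>\<C>\<in>bowen_covers X f E n r.
      (\<Sum>\<^sub>\<infinity>(x, u)\<in>\<C>. ennreal (exp (- t * real u))) \<le> ennreal e"
  shows "bowen_sum X f E t r = 0"
  unfolding bowen_sum_eq_0_iff
proof (intro allI impI)
  fix n and e :: ennreal assume "e > 0"
  then obtain d :: real where d: "d > 0" "ennreal d < e"
  proof -
    obtain d' where "0 < d'" "d' < e" using dense \<open>e > 0\<close> by blast
    then show thesis
      using that[of "enn2real d'"] by (cases d') auto
  qed
  with assms[OF d(1), of n] show "\<exists>\<C>\<in>bowen_covers X f E n r.
      (\<Sum>\<^sub>\<infinity>(x, u)\<in>\<C>. ennreal (exp (- t * real u))) < e"
    using le_less_trans by blast
qed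

lemma bowen_covers_subset:
  "E \<subseteq> E' \<Longrightarrow> bowen_covers X f E' n r \<subseteq> bowen_covers X f E n r"
  unfolding bowen_covers_def by blast

lemma bowen_sum_mono:
  assumes "E \<subseteq> E'"
  shows "bowen_sum X f E t r \<le> bowen_sum X f E' t r"
proof -
  have "bowen_sum_at X f E t n r \<le> bowen_sum_at X f E' t n r" for n
    unfolding bowen_sum_at_def using bowen_covers_subset[OF assms]
    by (intro INF_superset_mono) auto
  then show ?thesis
    unfolding bowen_sum_eq_SUP by (intro SUP_mono) auto
qed

lemma bowen_entropy_mono:
  assumes "E \<subseteq> E'"
  shows "bowen_entropy X f E \<le> bowen_entropy X f E'"
proof -
  have "bowen_sum X f E' t r = 0 \<Longrightarrow> bowen_sum X f E t r = 0" for t r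
    using bowen_sum_mono[OF assms, of X f t r] by simp
  then have "bowen_entropy_at X f E r \<le> bowen_entropy_at X f E' r" for r
    unfolding bowen_entropy_at_def by (intro Inf_superset_mono) auto
  then show ?thesis
    unfolding bowen_entropy_eq_SUP by (intro SUP_mono) auto
qed

lemma bowen_entropy_at_le_of_null:
  assumes "bowen_sum X f E t r = 0" "0 \<le> t"
  shows "bowen_entropy_at X f E r \<le> ereal t"
  unfolding bowen_entropy_at_def using assms by (intro Inf_lower) auto

text \<open>A single scale suffices for a lower bound, because the entropy is the supremum over all
  scales.\<close>

lemma bowen_entropy_ge:
  assumes "r > 0" and "\<And>t. 0 \<le> t \<Longrightarrow> t < \<tau> \<Longrightarrow> bowen_sum X f E t r \<noteq> 0"
  shows "ereal \<tau> \<le> bowen_entropy X f E"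
proof -
  have "ereal \<tau> \<le> bowen_entropy_at X f E r"
    unfolding bowen_entropy_at_def using assms(2) by (intro Inf_greatest) force
  also have "\<dots> \<le> bowen_entropy X f E"
    unfolding bowen_entropy_eq_SUP using assms(1) by (intro SUP_upper) auto
  finally show ?thesis .
qed

text \<open>This is what turns positive entropy of the correlated points into their
  existence.\<close>

lemma bowen_entropy_empty: "bowen_entropy X f {} = 0"
proof -
  have "bowen_sum X f {} 0 r = 0" for r
  proof (rule bowen_sum_nullI)
    fix n and e :: real
    have "{} \<in> bowen_covers X f {} n r"
      by (simp add: bowen_covers_def)
    then show "\<exists>\<C>\<in>bowen_covers X f {} n r. (\<Sum>\<^sub>\<infinity>(x, u)\<in>\<C>. ennreal (exp (- 0 * real u))) \<le> ennreal e"
      by (intro bexI[of _ "{}"]) auto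
  qed
  then have "bowen_entropy_at X f {} r \<le> 0" for r
    using bowen_entropy_at_le_of_null[of X f "{}" 0 r] by (simp add: zero_ereal_def)
  moreover have "0 \<le> bowen_entropy_at X f {} r" for r
    unfolding bowen_entropy_at_def by (rule Inf_greatest) auto
  ultimately have "bowen_entropy_at X f {} r = 0" for r
    by (meson antisym)
  then show ?thesis
    unfolding bowen_entropy_eq_SUP by (simp)
qed

text \<open>The cover of \<open>E i\<close> gets the share \<open>e / 2 ^ (i + 1)\<close> of the
  allowed weight \<open>e\<close>.\<close>

lemma bowen_sum_UN_null:
  fixes E :: "nat \<Rightarrow> 'a::metric_space set"
  assumes "\<And>i. bowen_sum X f (E i) t r = 0"
  shows "bowen_sum X f (\<Union>i. E i) t r = 0"
proof (rule bowen_sum_nullI)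
  fix n and e :: real assume e: "e > 0"
  let ?w = "\<lambda>(x::'a, u). ennreal (exp (- t * real u))"
  have "\<exists>\<C>\<in>bowen_covers X f (E i) n r. infsum ?w \<C> < ennreal (e * (1/2) ^ Suc i)" for i
    using assms[of i] e unfolding bowen_sum_eq_0_iff by simp
  then obtain C where C: "\<And>i. C i \<in> bowen_covers X f (E i) n r"
    and Cs: "\<And>i. infsum ?w (C i) < ennreal (e * (1/2) ^ Suc i)"
    by metis
  have "(\<Union>i. C i) \<in> bowen_covers X f (\<Union>i. E i) n r"
    using C unfolding bowen_covers_def by (auto, fastforce+)
  moreover have "infsum ?w (\<Union>i. C i) \<le> ennreal e"
  proof -
    have "infsum ?w (\<Union>i. C i) \<le> (\<Sum>i. infsum ?w (C i))"
      using infsum_UN_le[of ?w C UNIV] unfolding infsum_ennreal_nat .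
    also have "\<dots> \<le> (\<Sum>i. ennreal (e * (1/2) ^ Suc i))"
      using Cs by (intro suminf_le) (auto intro: less_imp_le)
    also have "\<dots> = ennreal (\<Sum>i. e * (1/2) ^ Suc i)"
      using e power_half_series by (intro suminf_ennreal2) (auto intro: summable_mult sums_summable)
    also have "(\<Sum>i. e * (1/2) ^ Suc i) = e"
      using sums_mult[OF power_half_series, of e] by (simp add: sums_iff)
    finally show ?thesis .
  qed
  ultimately show "\<exists>\<C>\<in>bowen_covers X f (\<Union>i. E i) n r. infsum ?w \<C> \<le> ennreal e"
    by blast
qed

lemma bowen_sum_countable_UN_null:
  assumes "countable I" "I \<noteq> {}" "\<And>i. i \<in> I \<Longrightarrow> bowen_sum X f (E i) t r = 0"
  shows "bowen_sum X f (\<Union>i\<in>I. E i) t r = 0"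
proof -
  have "(\<Union>i\<in>I. E i) = (\<Union>n. E (from_nat_into I n))"
    by (metis assms(1,2) image_image range_from_nat_into)
  then show ?thesis
    using bowen_sum_UN_null[of X f "\<lambda>n. E (from_nat_into I n)" t r] assms(2,3)
    by (simp add: from_nat_into)
qed

section \<open>Iterates on a compact invariant set; comparison of \<open>f\<close> with its
  power\<close>

lemma funpow_in_invariant:
  assumes "f ` X \<subseteq> X" "x \<in> X"
  shows "(f ^^ n) x \<in> X"
  using assms by (induction n) auto

lemma continuous_on_funpow:
  assumes "continuous_on X f" "f ` X \<subseteq> X"
  shows "continuous_on X (f ^^ n)"
proof (induction n)
  case (Suc n)
  have "(f ^^ n) ` X \<subseteq> X"
    using funpow_in_invariant[OF assms(2)] by blast
  then show ?case
    using continuous_on_compose2[OF assms(1) Suc] by (simp add: o_def)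
qed auto

lemma uniform_modulus_iterates:
  fixes X :: "'a::metric_space set"
  assumes "topological_dynamical_system X f" "e > 0"
  obtains d where "d > 0"
    "\<And>x y j. x \<in> X \<Longrightarrow> y \<in> X \<Longrightarrow> dist x y < d \<Longrightarrow> j < n \<Longrightarrow> dist ((f ^^ j) x) ((f ^^ j) y) < e"
proof -
  have "\<exists>d>0. \<forall>x\<in>X. \<forall>y\<in>X. dist x y < d \<longrightarrow> dist ((f ^^ j) x) ((f ^^ j) y) < e" for j
  proof -
    have "uniformly_continuous_on X (f ^^ j)"
      using assms unfolding topological_dynamical_system_def
      by (intro compact_uniformly_continuous continuous_on_funpow) auto
    then show ?thesis
      using \<open>e > 0\<close> unfolding uniformly_continuous_on_def by (metis dist_commute)
  qed
  then obtain d where d: "\<And>j. d j > 0"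
    "\<And>j x y. x \<in> X \<Longrightarrow> y \<in> X \<Longrightarrow> dist x y < d j \<Longrightarrow> dist ((f ^^ j) x) ((f ^^ j) y) < e"
    by metis
  show thesis
  proof (rule that[of "Min (insert 1 (d ` {..<n}))"])
    show "Min (insert 1 (d ` {..<n})) > 0"
      using d(1) by (subst Min_gr_iff) auto
  next
    fix x y j assume "x \<in> X" "y \<in> X" "dist x y < Min (insert 1 (d ` {..<n}))" "j < n"
    moreover from this have "Min (insert 1 (d ` {..<n})) \<le> d j"
      by (intro Min_le) auto
    ultimately show "dist ((f ^^ j) x) ((f ^^ j) y) < e"
      using d(2) by fastforce
  qed
qed

text \<open>By uniform continuity, \<open>f ^^ i\<close> with \<open>i < L\<close> maps an
  \<open>f ^^ L\<close>-Bowen ball of length \<open>u\<close> into an \<open>f\<close>-Bowen ball of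
  length \<open>L * u\<close> at a coarser scale. Exponent \<open>t\<close> then becomes
  \<open>t / L\<close> with the same weight, and using \<open>L\<close> images of each ball costs
  only a factor \<open>L\<close>.\<close>

lemma bowen_entropy_power_le:
  fixes X Y :: "'a::metric_space set"
  assumes tds: "topological_dynamical_system X f" and "L \<ge> 1"
    and X: "X = (\<Union>i\<in>{0..L-1}. (f ^^ i) ` Y)" and "Y \<subseteq> X"
  shows "bowen_entropy X f X \<le> ereal (1 / real L) * bowen_entropy X (f ^^ L) Y"
proof -
  have inv: "f ` X \<subseteq> X" using tds by (simp add: topological_dynamical_system_def)
  note fX = funpow_in_invariant[OF inv]
  have null: "\<exists>r>0. \<forall>t. bowen_sum X (f ^^ L) Y t r = 0 \<longrightarrow> bowen_sum X f X (t / real L) r' = 0"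
    if "r' > 0" for r'
  proof -
    \<comment> \<open>The range \<open>2 * L\<close> is needed because the shift
      \<open>i < L\<close> adds to the remainder \<open>j < L\<close> of the time modulo
      \<open>L\<close>.\<close>
    obtain r where r: "r > 0" "\<And>x y j. x \<in> X \<Longrightarrow> y \<in> X \<Longrightarrow> dist x y < r \<Longrightarrow> j < 2 * L
        \<Longrightarrow> dist ((f ^^ j) x) ((f ^^ j) y) < r'"
      using uniform_modulus_iterates[OF tds \<open>r' > 0\<close>] by metis
    have "bowen_sum X f X (t / real L) r' = 0" if t: "bowen_sum X (f ^^ L) Y t r = 0" for t
    proof (rule bowen_sum_nullI)
      fix n and e :: real assume "e > 0"
      let ?w = "\<lambda>t (x::'a, u). ennreal (exp (- t * real u))"
      obtain C where C: "C \<in> bowen_covers X (f ^^ L) Y n r" "infsum (?w t) C < ennreal (e / L)"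
      proof -
        have "ennreal (e / L) > 0"
          using \<open>e > 0\<close> \<open>L \<ge> 1\<close> by (simp add: ennreal_less_zero_iff)
        then show thesis
          using t that unfolding bowen_sum_eq_0_iff by blast
      qed
      define D where "D i = (\<lambda>(x, u). ((f ^^ i) x, L * u)) ` C" for i
      have "infsum (?w (t / real L)) (D i) \<le> infsum (?w t) C" for i
      proof -
        have "infsum (?w (t / real L)) (\<Union>c\<in>C. {(\<lambda>(x, u). ((f ^^ i) x, L * u)) c})
            \<le> (\<Sum>\<^sub>\<infinity>c\<in>C. infsum (?w (t / real L)) {(\<lambda>(x, u). ((f ^^ i) x, L * u)) c})"
          by (rule infsum_UN_le)
        also have "\<dots> = infsum (?w t) C"
          using \<open>L \<ge> 1\<close> by (intro infsum_cong) (auto split: prod.splits)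
        finally show ?thesis unfolding D_def by (simp add: UNION_singleton_eq_range)
      qed
      note Di = this
      have "infsum (?w (t / real L)) (\<Union>i\<in>{..<L}. D i) \<le> (\<Sum>i<L. infsum (?w (t / real L)) (D i))"
        using infsum_UN_le[of "?w (t / real L)" D "{..<L}"] by simp
      also have "\<dots> \<le> (\<Sum>i<L. infsum (?w t) C)"
        by (intro sum_mono Di)
      also have "\<dots> = of_nat L * infsum (?w t) C"
        by simp
      also have "\<dots> \<le> of_nat L * ennreal (e / L)"
        using C(2) by (intro mult_left_mono) auto
      also have "\<dots> = ennreal e"
        using \<open>L \<ge> 1\<close> \<open>e > 0\<close> by (simp add: ennreal_of_nat_eq_real_of_nat ennreal_mult[symmetric])
      finally have "infsum (?w (t / real L)) (\<Union>i\<in>{..<L}. D i) \<le> ennreal e" .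
      moreover have "(\<Union>i\<in>{..<L}. D i) \<in> bowen_covers X f X n r'"
        unfolding bowen_covers_def mem_Collect_eq
      proof (intro conjI)
        show "countable (\<Union>i\<in>{..<L}. D i)"
          using C(1) unfolding D_def bowen_covers_def by auto
        have "n \<le> u \<Longrightarrow> n \<le> L * u" for u
          using \<open>L \<ge> 1\<close> by (cases L) (auto simp: trans_le_add1)
        then show "\<forall>(x, u)\<in>\<Union> (D ` {..<L}). x \<in> X \<and> n \<le> u"
          using C(1) \<open>L \<ge> 1\<close> fX unfolding D_def bowen_covers_def by fastforce
        show "X \<subseteq> (\<Union>(x, u)\<in>\<Union> (D ` {..<L}). bowen_ball X f u x r')"
        proof
          fix x assume "x \<in> X"
          moreover have "{0..L-1} = {..<L}" using \<open>L \<ge> 1\<close> by auto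
          ultimately obtain i y where iy: "i < L" "y \<in> Y" "x = (f ^^ i) y"
            using X by blast
          obtain c u where cu: "(c, u) \<in> C" "y \<in> bowen_ball X (f ^^ L) u c r"
            using C(1) iy(2) unfolding bowen_covers_def by fast
          have "c \<in> X" using C(1) cu(1) unfolding bowen_covers_def by auto
          have "y \<in> X" using iy \<open>Y \<subseteq> X\<close> by auto
          have "x \<in> bowen_ball X f (L * u) ((f ^^ i) c) r'"
            unfolding bowen_ball_def mem_Collect_eq
          proof (intro conjI allI impI \<open>x \<in> X\<close>)
            fix m assume m: "m < L * u"
            define k j where "k = m div L" and "j = m mod L"
            have kj: "m = j + L * k" "j < L" "k < u"
              using m \<open>L \<ge> 1\<close> unfolding k_def j_def
              by (auto simp: less_mult_imp_div_less mult.commute)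
            have eq: "(f ^^ m) ((f ^^ i) z) = (f ^^ (j + i)) (((f ^^ L) ^^ k) z)" for z
              unfolding kj(1) funpow_mult by (metis add.commute add.assoc comp_apply funpow_add mult.commute)
            have "dist (((f ^^ L) ^^ k) c) (((f ^^ L) ^^ k) y) < r"
              using cu(2) kj(3) unfolding bowen_ball_def by auto
            then show "dist ((f ^^ m) ((f ^^ i) c)) ((f ^^ m) x) < r'"
              unfolding iy(3) eq using r(2) fX \<open>c \<in> X\<close> \<open>y \<in> X\<close> kj(2) iy(1)
              by (simp add: funpow_mult)
          qed
          moreover have "((f ^^ i) c, L * u) \<in> D i"
            using cu(1) unfolding D_def by force
          ultimately show "x \<in> (\<Union>(x, u)\<in>\<Union> (D ` {..<L}). bowen_ball X f u x r')"
            using iy(1) by fast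
        qed
      qed
      ultimately show "\<exists>\<C>\<in>bowen_covers X f X n r'. infsum (?w (t / real L)) \<C> \<le> ennreal e"
        by blast
    qed
    with r(1) show ?thesis by blast
  qed
  have "bowen_entropy_at X f X r' \<le> ereal (1 / real L) * bowen_entropy X (f ^^ L) Y" if r': "r' > 0" for r'
  \<comment> \<open>Comparing with real upper bounds \<open>z\<close> also covers an infinite
    right-hand side.\<close>
  proof (rule ereal_le_real)
    fix z assume z: "ereal (1 / real L) * bowen_entropy X (f ^^ L) Y \<le> ereal z"
    obtain r where r: "r > 0" "\<And>t. bowen_sum X (f ^^ L) Y t r = 0 \<Longrightarrow> bowen_sum X f X (t / real L) r' = 0"
      using null[OF r'] by blast
    have "ereal (1 / real L) * bowen_entropy_at X (f ^^ L) Y r \<le> ereal z"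
      using z r(1) \<open>L \<ge> 1\<close> unfolding bowen_entropy_eq_SUP
      by (meson SUP_upper ereal_mult_left_mono greaterThan_iff order_trans ereal_less_eq(5) of_nat_0_le_iff divide_nonneg_nonneg zero_le_one)
    then have le: "bowen_entropy_at X (f ^^ L) Y r \<le> ereal (z * real L)"
      using \<open>L \<ge> 1\<close> by (cases "bowen_entropy_at X (f ^^ L) Y r") (auto simp: field_simps)
    show "bowen_entropy_at X f X r' \<le> ereal z"
    proof (rule ereal_le_epsilon2)
      fix d :: real assume "d > 0"
      have "bowen_entropy_at X (f ^^ L) Y r < ereal ((z + d) * real L)"
        using le \<open>d > 0\<close> \<open>L \<ge> 1\<close> by (rule_tac le_less_trans) (auto)
      then obtain t where t: "0 \<le> t" "bowen_sum X (f ^^ L) Y t r = 0" "t < (z + d) * real L"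
        unfolding bowen_entropy_at_def Inf_less_iff by auto
      have "bowen_entropy_at X f X r' \<le> ereal (t / real L)"
        using r(2)[OF t(2)] t(1) by (intro bowen_entropy_at_le_of_null) auto
      also have "\<dots> \<le> ereal z + ereal d"
        using t(3) \<open>L \<ge> 1\<close> by (simp add: divide_simps)
      finally show "bowen_entropy_at X f X r' \<le> ereal z + ereal d" .
    qed
  qed
  then show ?thesis
    unfolding bowen_entropy_eq_SUP[of X f X] by (intro SUP_least) auto
qed

text \<open>The map \<open>cl\<close> serves as a finite-alphabet coding: points with the same
  symbol are within \<open>2 * e\<close> of each other.\<close>

lemma compact_cells:
  fixes Y :: "'a::metric_space set"
  assumes "compact Y" "e > 0"
  obtains V cl where "finite V" "\<And>y. y \<in> Y \<Longrightarrow> cl y \<in> V" "\<And>y. y \<in> Y \<Longrightarrow> dist (cl y) y < e"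
proof -
  have "\<exists>V. finite V \<and> Y \<subseteq> (\<Union>v\<in>V. ball v e)"
    using assms unfolding compact_eq_totally_bounded by blast
  then obtain V where V: "finite V" "Y \<subseteq> (\<Union>v\<in>V. ball v e)"
    by blast
  have "\<exists>v. v \<in> V \<and> dist v y < e" if "y \<in> Y" for y
  proof -
    obtain v where "v \<in> V" "y \<in> ball v e" using V(2) \<open>y \<in> Y\<close> by blast
    then show ?thesis by auto
  qed
  then obtain cl where "\<And>y. y \<in> Y \<Longrightarrow> cl y \<in> V \<and> dist (cl y) y < e"
    by metis
  with V(1) that show thesis by blast
qed

section \<open>Free concatenation of return words\<close>

text \<open>A separated set of maximal cardinality spans, since a point far from all its members
  could be added. The bound \<open>b\<close> guarantees that a maximum exists.\<close>

lemma maximal_separated_spanning: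
  fixes A :: "'a::metric_space set"
  assumes "r > 0" and bound: "\<And>S. finite S \<Longrightarrow> S \<subseteq> A
      \<Longrightarrow> (\<forall>x\<in>S. \<forall>y\<in>S. x \<noteq> y \<longrightarrow> (\<exists>i<n. r \<le> dist ((g ^^ i) x) ((g ^^ i) y))) \<Longrightarrow> real (card S) < b"
  obtains S where "finite S" "S \<subseteq> A" "real (card S) < b"
    "\<And>y. y \<in> A \<Longrightarrow> \<exists>x\<in>S. \<forall>i<n. dist ((g ^^ i) x) ((g ^^ i) y) < r"
proof -
  define P where "P S \<longleftrightarrow> finite S \<and> S \<subseteq> A \<and>
      (\<forall>x\<in>S. \<forall>y\<in>S. x \<noteq> y \<longrightarrow> (\<exists>i<n. r \<le> dist ((g ^^ i) x) ((g ^^ i) y)))" for S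
  have bnd: "real (card S) < b" if "P S" for S
    using that unfolding P_def by (intro bound) auto
  have "\<exists>S. P S \<and> (\<forall>T. P T \<longrightarrow> card T \<le> card S)"
  proof (rule ex_has_greatest_nat[of P "{}" card "nat \<lceil>b\<rceil> + 1"])
    show "P {}" by (simp add: P_def)
    show "\<forall>S. P S \<longrightarrow> card S < nat \<lceil>b\<rceil> + 1"
    proof (intro allI impI)
      fix S assume "P S"
      from bnd[OF this] show "card S < nat \<lceil>b\<rceil> + 1" by linarith
    qed
  qed
  then obtain S where S: "P S" and max: "\<And>T. P T \<Longrightarrow> card T \<le> card S"
    by blast
  show thesis
  proof (rule that[of S])
    fix y assume y: "y \<in> A"
    show "\<exists>x\<in>S. \<forall>i<n. dist ((g ^^ i) x) ((g ^^ i) y) < r"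
    proof (rule ccontr)
      assume no: "\<not> ?thesis"
      then have "y \<notin> S"
        using \<open>r > 0\<close> by auto
      have far: "\<exists>i<n. r \<le> dist ((g ^^ i) x) ((g ^^ i) y)" if "x \<in> S" for x
        using no that by (meson not_less)
      then have far': "\<exists>i<n. r \<le> dist ((g ^^ i) y) ((g ^^ i) x)" if "x \<in> S" for x
        using that by (metis dist_commute)
      have "P (insert y S)"
        using S y far far' unfolding P_def by simp
      from max[OF this] \<open>y \<notin> S\<close> S show False
        by (simp add: P_def)
    qed
  qed (use S bnd in \<open>auto simp: P_def\<close>)
qed

text \<open>Points of \<open>Y\<close> return infinitely often to one of finitely many small cells. If the
  return words to every cell had growth rate below \<open>t\<close>, covering by return words of large
  length would make \<open>Y\<close> null at exponent \<open>t\<close>.\<close>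

lemma many_separated_loops:
  fixes X Y :: "'a::metric_space set" and s t r \<delta> :: real
  assumes Y: "compact Y" "Y \<noteq> {}" "Y \<subseteq> X" "g ` Y \<subseteq> Y"
    and t: "ereal t < bowen_entropy_at X g Y r"
    and "0 \<le> s" "s < t" "r > 0" "\<delta> > 0"
  obtains n S where "n \<ge> n0" "finite S" "S \<subseteq> Y" "exp (s * real n) \<le> real (card S)"
    "\<And>x y. x \<in> S \<Longrightarrow> y \<in> S \<Longrightarrow> dist ((g ^^ n) x) y < \<delta>"
    "\<And>x y. x \<in> S \<Longrightarrow> y \<in> S \<Longrightarrow> x \<noteq> y \<Longrightarrow> \<exists>i<n. r / 2 \<le> dist ((g ^^ i) x) ((g ^^ i) y)"
proof (rule ccontr)
  assume not_thesis: "\<not> thesis"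
  note found = that
  note gY = funpow_in_invariant[OF Y(4)]
  \<comment> \<open>Two codings are used: cells of radius \<open>\<delta> / 2\<close> detect
    returns, and cells of radius \<open>r / 4\<close> record the orbit before the first visit that
    is considered.\<close>
  obtain V vl where V: "finite V" and vl: "\<And>y. y \<in> Y \<Longrightarrow> vl y \<in> V" "\<And>y. y \<in> Y \<Longrightarrow> dist (vl y) y < \<delta> / 2"
    by (rule compact_cells[OF Y(1), of "\<delta> / 2"]) (use \<open>\<delta> > 0\<close> in auto)
  obtain C cl where C: "finite C" and cl: "\<And>y. y \<in> Y \<Longrightarrow> cl y \<in> C" "\<And>y. y \<in> Y \<Longrightarrow> dist (cl y) y < r / 4"
    by (rule compact_cells[OF Y(1), of "r / 4"]) (use \<open>r > 0\<close> in auto)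
  define Lp where "Lp v n = {y \<in> Y. y \<in> ball v (\<delta> / 2) \<and> (g ^^ n) y \<in> ball v (\<delta> / 2)}" for v n
  \<comment> \<open>Any two loops at the same cell can be joined with a gap below
    \<open>\<delta>\<close>, so the assumed failure of the claim bounds every separated set of loops
    by \<open>exp (s * n)\<close>.\<close>
  have spans: "\<exists>S. finite S \<and> S \<subseteq> Lp v n \<and> real (card S) < exp (s * real n) \<and>
      (\<forall>y\<in>Lp v n. \<exists>x\<in>S. \<forall>i<n. dist ((g ^^ i) x) ((g ^^ i) y) < r / 2)" if "n \<ge> n0" for v n
  proof (rule maximal_separated_spanning[of "r / 2" "Lp v n" n g "exp (s * real n)"])
    fix S assume S: "finite S" "S \<subseteq> Lp v n"
      "\<forall>x\<in>S. \<forall>y\<in>S. x \<noteq> y \<longrightarrow> (\<exists>i<n. r / 2 \<le> dist ((g ^^ i) x) ((g ^^ i) y))"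
    have "dist ((g ^^ n) x) y < \<delta>" if "x \<in> S" "y \<in> S" for x y
    proof -
      have "dist v ((g ^^ n) x) < \<delta> / 2" "dist v y < \<delta> / 2"
        using that S(2) by (auto simp: Lp_def)
      then show ?thesis
        using dist_triangle3[of "(g ^^ n) x" y v] by linarith
    qed
    moreover have "S \<subseteq> Y" using S(2) by (auto simp: Lp_def)
    ultimately show "real (card S) < exp (s * real n)"
      using found[of n S] not_thesis S \<open>n \<ge> n0\<close> by (meson not_less)
  qed (use \<open>r > 0\<close> in auto)
  define S where "S v n = (SOME S. finite S \<and> S \<subseteq> Lp v n \<and> real (card S) < exp (s * real n) \<and>
      (\<forall>y\<in>Lp v n. \<exists>x\<in>S. \<forall>i<n. dist ((g ^^ i) x) ((g ^^ i) y) < r / 2))" for v n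
  have S: "finite (S v n)" "real (card (S v n)) < exp (s * real n)"
    "\<And>y. y \<in> Lp v n \<Longrightarrow> \<exists>x\<in>S v n. \<forall>i<n. dist ((g ^^ i) x) ((g ^^ i) y) < r / 2"
    if "n \<ge> n0" for v n
    using someI_ex[OF spans[OF that, of v]] unfolding S_def[symmetric] by simp_all
  \<comment> \<open>Visit at time \<open>p\<close> to the cell at \<open>v\<close>, followed by
    infinitely many returns. There are countably many such pairs, and by pigeonhole these sets cover
    \<open>Y\<close>.\<close>
  define D where "D = (\<lambda>(p, v). {y \<in> Y. (g ^^ p) y \<in> ball v (\<delta> / 2) \<and>
      infinite {m. (g ^^ m) y \<in> ball v (\<delta> / 2)}})"
  have null: "bowen_sum X g (D (p, v)) t r = 0" for p v
  proof (rule bowen_sum_nullI)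
    fix N and e :: real assume "e > 0"
    let ?w = "\<lambda>(x::'a, u). ennreal (exp (- t * real u))"
    define q where "q = exp (s - t)"
    have q: "0 < q" "q < 1" using \<open>s < t\<close> by (auto simp: q_def)
    \<comment> \<open>\<open>K\<close> counts the codes of the first \<open>p\<close> steps. Balls
      of length \<open>p + n\<close> then have total weight at most \<open>K * q ^ n\<close>, and
      the tail from \<open>m\<close> on is geometric.\<close>
    define K where "K = real (card C) ^ p"
    have "(\<lambda>n. K / (1 - q) * q ^ n) \<longlonglongrightarrow> K / (1 - q) * 0"
      using q by (intro tendsto_mult_left LIMSEQ_power_zero) auto
    then have "\<forall>\<^sub>F n in sequentially. K / (1 - q) * q ^ n < e"
      using \<open>e > 0\<close> by (intro order_tendstoD) auto
    then obtain m1 where m1: "\<And>n. n \<ge> m1 \<Longrightarrow> K / (1 - q) * q ^ n < e"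
      unfolding eventually_sequentially by blast
    define m where "m = max m1 (max N n0)"
    have m: "K / (1 - q) * q ^ m < e" "N \<le> m" "n0 \<le> m"
      using m1[of m] by (auto simp: m_def)
    \<comment> \<open>Points with initial code \<open>\<kappa>\<close> that follow the spanning
      point \<open>x\<close> from time \<open>p\<close> on. As \<open>x\<close> describes only the
      later part of the orbit, the ball centre \<open>a n c\<close> is chosen among the points of
      \<open>A n c\<close>; the radii \<open>r / 4\<close> and \<open>r / 2\<close> leave room for
      this change of centre.\<close>
    define A where "A n = (\<lambda>(\<kappa>, x). {y \<in> Y. (\<forall>i<p. cl ((g ^^ i) y) = \<kappa> i) \<and>
        (\<forall>i<n. dist ((g ^^ i) x) ((g ^^ (p + i)) y) < r / 2)})" for n
    define I where "I n = {c \<in> ({..<p} \<rightarrow>\<^sub>E C) \<times> S v n. A n c \<noteq> {}}" for n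
    define a where "a n c = (SOME y. y \<in> A n c)" for n c
    have a: "a n c \<in> A n c" if "c \<in> I n" for n c
      using that unfolding a_def I_def by (simp add: some_in_eq)
    define T where "T n = (\<lambda>c. (a n c, p + n)) ` I n" for n
    have finI: "finite (I n)" and cardT: "real (card (T n)) \<le> K * exp (s * real n)" if "n \<ge> n0" for n
    proof -
      have fin: "finite (({..<p} \<rightarrow>\<^sub>E C) \<times> S v n)"
        using S(1)[OF that] C by (auto intro!: finite_PiE)
      then show "finite (I n)" by (simp add: I_def)
      then have "card (T n) \<le> card (({..<p} \<rightarrow>\<^sub>E C) \<times> S v n)"
        using fin unfolding T_def by (intro order_trans[OF card_image_le] card_mono) (auto simp: I_def)
      also have "\<dots> = card C ^ p * card (S v n)"
        by (simp add: card_cartesian_product card_PiE)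
      finally have "real (card (T n)) \<le> K * real (card (S v n))"
        unfolding K_def by (metis of_nat_le_iff of_nat_mult of_nat_power)
      also have "\<dots> \<le> K * exp (s * real n)"
        using S(2)[OF that, of v] by (intro mult_left_mono) (auto simp: K_def)
      finally show "real (card (T n)) \<le> K * exp (s * real n)" .
    qed
    have "infsum ?w (\<Union>n\<in>{m..}. T n) \<le> ennreal e"
    proof -
      have "infsum ?w (T n) \<le> ennreal (K * q ^ n)" if "n \<in> {m..}" for n
      proof -
        have "finite (T n)" using finI m(3) that by (auto simp: T_def)
        then have "infsum ?w (T n) = (\<Sum>c\<in>T n. ?w c)" by simp
        also have "\<dots> = (\<Sum>c\<in>T n. ennreal (exp (- t * real (p + n))))"
          by (intro sum.cong) (auto simp: T_def)
        also have "\<dots> = ennreal (real (card (T n)) * exp (- t * real (p + n)))"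
          by (simp add: ennreal_mult ennreal_of_nat_eq_real_of_nat)
        also have "\<dots> \<le> ennreal (K * exp (s * real n) * exp (- t * real n))"
          using cardT[of n] that m(3) \<open>s < t\<close> \<open>0 \<le> s\<close>
          by (intro ennreal_leI mult_mono) (auto simp: K_def)
        also have "K * exp (s * real n) * exp (- t * real n) = K * q ^ n"
          by (simp add: q_def exp_of_nat_mult[symmetric] exp_add[symmetric] algebra_simps)
        finally show ?thesis .
      qed
      then have "infsum ?w (\<Union>n\<in>{m..}. T n) \<le> (\<Sum>\<^sub>\<infinity>n\<in>{m..}. ennreal (K * q ^ n))"
        by (intro order_trans[OF infsum_UN_le] infsum_ennreal_mono)
      also have "\<dots> = (\<Sum>k. ennreal (K * q ^ m * q ^ k))"
      proof -
        have "{m..} = range (\<lambda>k. m + k)"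
          by (auto simp: image_iff le_iff_add)
        then show ?thesis
          by (simp add: infsum_reindex o_def infsum_ennreal_nat power_add mult.assoc)
      qed
      also have "\<dots> = ennreal (\<Sum>k. K * q ^ m * q ^ k)"
        using q by (intro suminf_ennreal2 summable_mult summable_geometric) (auto simp: K_def)
      also have "(\<Sum>k. K * q ^ m * q ^ k) = K / (1 - q) * q ^ m"
        using q by (subst suminf_mult) (auto simp: suminf_geometric summable_geometric)
      also have "ennreal \<dots> \<le> ennreal e"
        using m(1) by (intro ennreal_leI) auto
      finally show ?thesis .
    qed
    moreover have "(\<Union>n\<in>{m..}. T n) \<in> bowen_covers X g (D (p, v)) N r"
      unfolding bowen_covers_def mem_Collect_eq
    proof (intro conjI)
      show "countable (\<Union>n\<in>{m..}. T n)"
        using finI m(3) unfolding T_def by (auto intro!: countable_UN countable_image intro: countable_finite)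
      show "\<forall>(x, u)\<in>\<Union> (T ` {m..}). x \<in> X \<and> N \<le> u"
      proof -
        have "a n c \<in> X" if "c \<in> I n" for n c
          using a[OF that] Y(3) unfolding A_def by (auto split: prod.splits)
        then show ?thesis using m(2) unfolding T_def by auto
      qed
      show "D (p, v) \<subseteq> (\<Union>(x, u)\<in>\<Union> (T ` {m..}). bowen_ball X g u x r)"
      proof
        fix y assume y: "y \<in> D (p, v)"
        then have yY: "y \<in> Y" by (simp add: D_def)
        obtain m' where m': "m' \<ge> m + p" "(g ^^ m') y \<in> ball v (\<delta> / 2)"
          using y unfolding D_def infinite_nat_iff_unbounded_le by auto
        define n where "n = m' - p"
        have n: "n \<ge> m" "n \<ge> n0" "m' = n + p" using m' m(3) by (auto simp: n_def)
        have "(g ^^ p) y \<in> Lp v n"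
          using y m'(2) gY[OF yY] unfolding D_def Lp_def n(3) by (auto simp: funpow_add)
        then obtain x where x: "x \<in> S v n" "\<And>i. i < n \<Longrightarrow> dist ((g ^^ i) x) ((g ^^ i) ((g ^^ p) y)) < r / 2"
          using S(3)[OF n(2), of "(g ^^ p) y" v] by blast
        define \<kappa> where "\<kappa> = restrict (\<lambda>i. cl ((g ^^ i) y)) {..<p}"
        have yA: "y \<in> A n (\<kappa>, x)"
          using yY x(2) unfolding A_def \<kappa>_def
          by (auto simp: funpow_add add.commute[of p])
        then have c: "(\<kappa>, x) \<in> I n"
          using x(1) cl gY[OF yY] unfolding I_def by (auto simp: \<kappa>_def)
        define z where "z = a n (\<kappa>, x)"
        have zA: "z \<in> A n (\<kappa>, x)" unfolding z_def by (rule a[OF c])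
        have "y \<in> bowen_ball X g (p + n) z r"
          unfolding bowen_ball_def mem_Collect_eq
        proof (intro conjI allI impI)
          show "y \<in> X" using yY Y(3) by auto
          fix i assume i: "i < p + n"
          show "dist ((g ^^ i) z) ((g ^^ i) y) < r"
          proof (cases "i < p")
            case True
            then have "cl ((g ^^ i) y) = cl ((g ^^ i) z)"
              using yA zA by (auto simp: A_def)
            moreover have "z \<in> Y" using zA by (auto simp: A_def)
            ultimately have "dist (cl ((g ^^ i) y)) ((g ^^ i) z) < r / 4"
              "dist (cl ((g ^^ i) y)) ((g ^^ i) y) < r / 4"
              using cl gY yY by (metis, metis)
            then show ?thesis
              using dist_triangle3[of "(g ^^ i) z" "(g ^^ i) y" "cl ((g ^^ i) y)"] \<open>r > 0\<close> by linarith
          next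
            case False
            define k where "k = i - p"
            have k: "i = p + k" "k < n" using False i by (auto simp: k_def)
            have "dist ((g ^^ k) x) ((g ^^ i) z) < r / 2" "dist ((g ^^ k) x) ((g ^^ i) y) < r / 2"
              using yA zA k by (auto simp: A_def)
            then show ?thesis
              using dist_triangle3[of "(g ^^ i) z" "(g ^^ i) y" "(g ^^ k) x"] by linarith
          qed
        qed
        moreover have "(z, p + n) \<in> T n" unfolding T_def z_def using c by blast
        ultimately show "y \<in> (\<Union>(x, u)\<in>\<Union> (T ` {m..}). bowen_ball X g u x r)"
          using n(1) by (intro UN_I[of "(z, p + n)"]) auto
      qed
    qed
    ultimately show "\<exists>\<C>\<in>bowen_covers X g (D (p, v)) N r. infsum ?w \<C> \<le> ennreal e"
      by blast
  qed
  have "Y \<subseteq> (\<Union>c\<in>UNIV \<times> V. D c)"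
  proof
    fix y assume y: "y \<in> Y"
    define h where "h m = vl ((g ^^ m) y)" for m
    have h: "\<And>m. h m \<in> V" "\<And>m. (g ^^ m) y \<in> ball (h m) (\<delta> / 2)"
      using vl gY[OF y] by (auto simp: h_def)
    have "finite (range h)" using h(1) V by (meson finite_subset image_subsetI)
    then obtain m0 where "infinite {m. h m = h m0}"
      using pigeonhole_infinite[of UNIV h] by auto
    then have "infinite {m. (g ^^ m) y \<in> ball (h m0) (\<delta> / 2)}"
      using h(2) by (elim infinite_super[rotated]) (metis (mono_tags, lifting) mem_Collect_eq subsetI)
    then have "y \<in> D (m0, h m0)" using y h(2) by (auto simp: D_def)
    then show "y \<in> (\<Union>c\<in>UNIV \<times> V. D c)" using h(1) by blast
  qed
  moreover have "bowen_sum X g (\<Union>c\<in>UNIV \<times> V. D c) t r = 0"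
    using V vl(1) Y(2) null by (intro bowen_sum_countable_UN_null) (auto simp: countable_finite)
  ultimately have "bowen_sum X g Y t r = 0"
    by (metis bowen_sum_mono le_zero_eq)
  then show False
    using bowen_entropy_at_le_of_null[of X g Y t r] t \<open>0 \<le> s\<close> \<open>s < t\<close> by auto
qed

section \<open>Markers\<close>

definition marker :: "('b \<Rightarrow> nat \<Rightarrow> 'a) \<Rightarrow> nat \<Rightarrow> 'b \<Rightarrow> 'b \<Rightarrow> nat \<Rightarrow> 'a" where
  "marker w N a b m = (if m < N then w a m else w b (m - N))"

definition separated_words :: "('b \<Rightarrow> nat \<Rightarrow> 'a::metric_space) \<Rightarrow> nat \<Rightarrow> 'b set \<Rightarrow> real \<Rightarrow> bool" where
  "separated_words w N S r \<longleftrightarrow> (\<forall>x\<in>S. \<forall>y\<in>S. x \<noteq> y \<longrightarrow> (\<exists>m<N. r \<le> dist (w x m) (w y m)))"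

definition self_overlaps :: "(nat \<Rightarrow> 'a::metric_space) \<Rightarrow> nat \<Rightarrow> nat \<Rightarrow> real \<Rightarrow> bool" where
  "self_overlaps W n J \<eta> \<longleftrightarrow> (\<forall>m<n - J. dist (W (m + J)) (W m) < \<eta>)"

lemma separated_wordsD:
  "separated_words w N S r \<Longrightarrow> x \<in> S \<Longrightarrow> y \<in> S \<Longrightarrow> (\<And>m. m < N \<Longrightarrow> dist (w x m) (w y m) < r) \<Longrightarrow> x = y"
  unfolding separated_words_def by (meson not_less)

text \<open>If \<open>a b\<close> overlaps itself with shift \<open>J\<close>, then \<open>b\<close> is, up to an error growing
  linearly in the number of shifts, a periodic continuation of the end of \<open>a\<close>. Recording the
  cell of \<open>b\<close> during one period out of \<open>l0\<close> stops the error from growing, and costs only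
  \<open>N div l0\<close> cells.\<close>

lemma card_self_overlapping_le:
  fixes w :: "'b \<Rightarrow> nat \<Rightarrow> 'a::metric_space"
  assumes "finite S" and sep: "separated_words w N S r"
    and V: "finite V" "\<And>x m. x \<in> S \<Longrightarrow> cl (w x m) \<in> V" "\<And>x m. x \<in> S \<Longrightarrow> dist (cl (w x m)) (w x m) < r / 8"
    and l0: "l0 \<ge> 1" and \<eta>: "2 * \<eta> * real l0 \<le> 3 / 4 * r" "\<eta> > 0"
    and J: "1 \<le> J" "J < N"
  shows "card {b \<in> S. self_overlaps (marker w N a b) (2 * N) J \<eta>} \<le> card V ^ (N div l0)"
proof (cases "S = {}")
  case False
  then have "V \<noteq> {}"
    using V(2) by blast
  then have V0: "card V \<ge> 1"
    using V(1) by (simp add: Suc_le_eq card_gt_0_iff)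
  define B where "B = {b \<in> S. self_overlaps (marker w N a b) (2 * N) J \<eta>}"
  \<comment> \<open>The recorded positions: every \<open>l0\<close>-th period of length
    \<open>J\<close>. The zeroth period is left out, since there \<open>b\<close> is compared
    directly with the end of \<open>a\<close>.\<close>
  define Q where "Q = {l. J \<le> l \<and> l < N \<and> (l div J) mod l0 = 0}"
  have Q: "finite Q" "card Q \<le> N div l0"
  proof -
    have "Q \<subseteq> (\<lambda>(c, i). c * l0 * J + i) ` ({1..N div l0 div J} \<times> {..<J})"
    proof
      fix l assume l: "l \<in> Q"
      define c where "c = l div J div l0"
      have "l div J = c * l0"
        using l by (auto simp: Q_def c_def)
      then have eq: "l = c * l0 * J + l mod J"
        by (metis div_mult_mod_eq)
      have "l div J \<ge> 1"
        using l J(1) by (simp add: Q_def Suc_le_eq div_greater_zero_iff)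
      then have "c \<ge> 1"
        using \<open>l div J = c * l0\<close> by (cases c) auto
      moreover have "c \<le> N div l0 div J"
      proof -
        have "l div (J * l0) \<le> N div (J * l0)"
          using l by (intro div_le_mono) (simp add: Q_def)
        then show ?thesis
          unfolding c_def by (metis div_mult2_eq mult.commute)
      qed
      ultimately show "l \<in> (\<lambda>(c, i). c * l0 * J + i) ` ({1..N div l0 div J} \<times> {..<J})"
        using eq J(1) by (intro image_eqI[of _ _ "(c, l mod J)"]) auto
    qed
    moreover have fin: "finite ({1..N div l0 div J} \<times> {..<J})" by simp
    ultimately have "card Q \<le> card ({1..N div l0 div J} \<times> {..<J})"
      by (meson card_image_le card_mono finite_imageI le_trans)
    also have "\<dots> = (N div l0 div J) * J" by simp
    also have "\<dots> \<le> N div l0" by simp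
    finally show "card Q \<le> N div l0" .
    show "finite Q" unfolding Q_def by auto
  qed
  define code where "code b = restrict (\<lambda>l. cl (w b l)) Q" for b
  have "inj_on code B"
  proof (rule inj_onI)
    fix b b' assume b: "b \<in> B" "b' \<in> B" "code b = code b'"
    have bS: "b \<in> S" "b' \<in> S" using b by (auto simp: B_def)
    \<comment> \<open>The overlap compares position \<open>N + l\<close> of the marker with
      \<open>N + l - J\<close>, which still lies in \<open>a\<close> exactly when
      \<open>l < J\<close>.\<close>
    have near: "dist (w c l) (if l < J then w a (N - J + l) else w c (l - J)) < \<eta>"
      if "c \<in> B" "l < N" for c l
    proof -
      have over: "\<forall>m<2 * N - J. dist (marker w N a c (m + J)) (marker w N a c m) < \<eta>"
        using that(1) by (simp add: B_def self_overlaps_def)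
      define K where "K = N - J + l"
      have K: "K < 2 * N - J" "K + J = N + l" "l < J \<Longrightarrow> K < N" "\<not> l < J \<Longrightarrow> \<not> K < N \<and> K - N = l - J"
        using that(2) J by (auto simp: K_def)
      with over have "dist (marker w N a c (N + l)) (marker w N a c K) < \<eta>"
        by metis
      moreover have "marker w N a c (N + l) = w c l"
        by (simp add: marker_def)
      moreover have "marker w N a c K = (if l < J then w a K else w c (l - J))"
        using K(3) K(4) by (cases "l < J") (simp_all add: marker_def)
      ultimately show ?thesis
        unfolding K_def by (simp only:)
    qed
    \<comment> \<open>Each shift by \<open>J\<close> adds at most \<open>2 * \<eta>\<close>, and
      equal codes reset the distance to below \<open>r / 4\<close>. At most \<open>l0\<close> shifts
      are ever accumulated, so the total stays below \<open>r\<close>.\<close>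
    have close: "dist (w b l) (w b' l) < r / 4 + 2 * \<eta> * real ((l div J) mod l0 + 1)" if "l < N" for l
      using that
    proof (induction l rule: less_induct)
      case (less l)
      have rpos: "r > 0" using V(3)[OF bS(1), of 0] zero_le_dist[of "cl (w b 0)" "w b 0"] by linarith
      consider "l < J" | "l \<ge> J" "(l div J) mod l0 = 0" | "l \<ge> J" "(l div J) mod l0 \<noteq> 0"
        by linarith
      then show ?case
      proof cases
        case 1
        then have "dist (w b l) (w a (N - J + l)) < \<eta>" "dist (w b' l) (w a (N - J + l)) < \<eta>"
          using near[OF b(1) less.prems] near[OF b(2) less.prems] by auto
        then have "dist (w b l) (w b' l) < 2 * \<eta>"
          using dist_triangle2[of "w b l" "w b' l" "w a (N - J + l)"] by linarith
        then show ?thesis using 1 rpos by simp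
      next
        case 2
        then have "l \<in> Q" using less.prems by (auto simp: Q_def)
        then have eq: "cl (w b l) = cl (w b' l)"
          using b(3) unfolding code_def by (metis restrict_apply')
        have "dist (w b l) (w b' l) \<le> dist (cl (w b l)) (w b l) + dist (cl (w b l)) (w b' l)"
          by (rule dist_triangle3)
        also have "\<dots> < r / 8 + r / 8"
          using V(3)[OF bS(1), of l] V(3)[OF bS(2), of l] eq by (intro add_strict_mono) auto
        finally show ?thesis using 2 \<eta>(2) by simp
      next
        case 3
        have "l - J < l" using 3 J by auto
        then have IH: "dist (w b (l - J)) (w b' (l - J)) < r / 4 + 2 * \<eta> * real (((l - J) div J) mod l0 + 1)"
          using less by auto
        have "(l - J) div J = l div J - 1"
          using 3 J by (simp add: le_div_geq)
        moreover have "(l div J - 1) mod l0 + 1 = (l div J) mod l0"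
        proof -
          have "l div J \<noteq> 0" using 3(2) by (intro notI) simp
          then obtain k where "l div J = Suc k" by (cases "l div J") auto
          then show ?thesis using 3(2) by (simp add: mod_Suc split: if_splits)
        qed
        ultimately have IH: "dist (w b (l - J)) (w b' (l - J)) < r / 4 + 2 * \<eta> * real ((l div J) mod l0)"
          using IH by simp
        have "dist (w b l) (w b (l - J)) < \<eta>" "dist (w b' l) (w b' (l - J)) < \<eta>"
          using near[OF b(1) less.prems] near[OF b(2) less.prems] 3 by auto
        moreover have "dist (w b l) (w b' l) \<le> dist (w b l) (w b (l - J)) +
            (dist (w b (l - J)) (w b' (l - J)) + dist (w b' l) (w b' (l - J)))"
          using dist_triangle[of "w b l" "w b' l" "w b (l - J)"]
            dist_triangle2[of "w b (l - J)" "w b' l" "w b' (l - J)"] by linarith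
        ultimately show ?thesis using IH by (simp add: algebra_simps)
      qed
    qed
    show "b = b'"
    proof (rule separated_wordsD[OF sep bS])
      fix l assume "l < N"
      have "real ((l div J) mod l0 + 1) \<le> real l0"
        using l0 by (intro of_nat_mono) (simp add: Suc_leI)
      then have "2 * \<eta> * real ((l div J) mod l0 + 1) \<le> 2 * \<eta> * real l0"
        using \<eta>(2) by (intro mult_left_mono) auto
      then show "dist (w b l) (w b' l) < r"
        using close[OF \<open>l < N\<close>] \<eta>(1) by linarith
    qed
  qed
  moreover have "code ` B \<subseteq> Q \<rightarrow>\<^sub>E V"
    using V(2) by (auto simp: code_def B_def)
  ultimately have "card B \<le> card (Q \<rightarrow>\<^sub>E V)"
    using Q(1) V(1) by (intro card_inj_on_le[of code]) (auto intro: finite_PiE)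
  also have "\<dots> = card V ^ card Q"
    using Q(1) by (simp add: card_PiE)
  also have "\<dots> \<le> card V ^ (N div l0)"
    using Q(2) V0 by (intro power_increasing) auto
  finally show ?thesis unfolding B_def .
qed simp

text \<open>With \<open>a\<close> fixed, adding the bound for self-overlapping markers over all
  shifts \<open>J < N\<close>, and one more for \<open>a\<close> itself, does not exhaust
  \<open>S\<close>.\<close>

lemma exists_marker:
  fixes w :: "'b \<Rightarrow> nat \<Rightarrow> 'a::metric_space"
  assumes "finite S" and sep: "separated_words w N S r"
    and V: "finite V" "\<And>x m. x \<in> S \<Longrightarrow> cl (w x m) \<in> V" "\<And>x m. x \<in> S \<Longrightarrow> dist (cl (w x m)) (w x m) < r / 8"
    and l0: "l0 \<ge> 1" and \<eta>: "2 * \<eta> * real l0 \<le> 3 / 4 * r" "\<eta> > 0"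
    and card: "1 + N * card V ^ (N div l0) < card S"
  obtains b where "b \<in> S" "b \<noteq> a" "\<And>J. 1 \<le> J \<Longrightarrow> J < N \<Longrightarrow> \<not> self_overlaps (marker w N a b) (2 * N) J \<eta>"
proof -
  let ?B = "\<lambda>J. {b \<in> S. self_overlaps (marker w N a b) (2 * N) J \<eta>}"
  have fin: "finite (\<Union>J\<in>{1..<N}. ?B J)" using assms(1) by auto
  have "card (insert a (\<Union>J\<in>{1..<N}. ?B J)) \<le> 1 + card (\<Union>J\<in>{1..<N}. ?B J)"
    using fin by (simp add: card_insert_if)
  also have "\<dots> \<le> 1 + (\<Sum>J\<in>{1..<N}. card (?B J))"
    by (intro add_left_mono card_UN_le) simp
  also have "\<dots> \<le> 1 + (\<Sum>J\<in>{1..<N}. card V ^ (N div l0))"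
    using card_self_overlapping_le[OF assms(1) sep V l0 \<eta>] by (intro add_left_mono sum_mono) auto
  also have "\<dots> \<le> 1 + N * card V ^ (N div l0)"
    by simp
  also note card
  finally have "\<not> S \<subseteq> insert a (\<Union>J\<in>{1..<N}. ?B J)"
    using fin by (meson card_mono finite.insertI leD)
  then obtain b where "b \<in> S" "b \<notin> insert a (\<Union>J\<in>{1..<N}. ?B J)"
    by blast
  then show thesis
    using that[of b] by auto
qed

text \<open>The words which can lie entirely inside an occurrence of \<open>W\<close> shifted by some
  \<open>0 < j < N\<close> are discarded; separation leaves at most one of them for each \<open>j\<close>.\<close>

definition marker_free :: "('b \<Rightarrow> nat \<Rightarrow> 'a::metric_space) \<Rightarrow> nat \<Rightarrow> 'b set \<Rightarrow> (nat \<Rightarrow> 'a) \<Rightarrow> real \<Rightarrow> 'b set" where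
  "marker_free w N S W \<eta> = {y \<in> S. \<forall>j. 0 < j \<and> j < N \<longrightarrow> (\<exists>l<N. \<eta> \<le> dist (w y l) (W (N - j + l)))}"

text \<open>The loss is only linear in \<open>N\<close>, hence harmless against exponentially many
  words.\<close>

lemma card_marker_free:
  fixes w :: "'b \<Rightarrow> nat \<Rightarrow> 'a::metric_space"
  assumes "finite S" and sep: "separated_words w N S r" and \<eta>: "2 * \<eta> \<le> r"
  shows "card S \<le> card (marker_free w N S W \<eta> - {a, b}) + N + 2"
proof -
  define B where "B j = {y \<in> S. \<forall>l<N. dist (w y l) (W (N - j + l)) < \<eta>}" for j
  have B1: "card (B j) \<le> 1" for j
  proof -
    have "x = y" if "x \<in> B j" "y \<in> B j" for x y
    proof (rule separated_wordsD[OF sep])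
      fix m assume "m < N"
      then have "dist (w x m) (W (N - j + m)) < \<eta>" "dist (w y m) (W (N - j + m)) < \<eta>"
        using that by (auto simp: B_def)
      then show "dist (w x m) (w y m) < r"
        using dist_triangle2[of "w x m" "w y m" "W (N - j + m)"] \<eta> by linarith
    qed (use that in \<open>auto simp: B_def\<close>)
    moreover have "finite (B j)" using assms(1) by (simp add: B_def)
    ultimately show ?thesis by (simp add: card_le_Suc0_iff_eq)
  qed
  have "S \<subseteq> (marker_free w N S W \<eta> - {a, b}) \<union> (\<Union>j\<in>{..<N}. B j) \<union> {a, b}"
    by (force simp: marker_free_def B_def not_less)
  then have "card S \<le> card ((marker_free w N S W \<eta> - {a, b}) \<union> (\<Union>j\<in>{..<N}. B j) \<union> {a, b})"
    using assms(1) by (intro card_mono) (auto simp: marker_free_def B_def)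
  also have "\<dots> \<le> card (marker_free w N S W \<eta> - {a, b}) + card (\<Union>j\<in>{..<N}. B j) + card {a, b}"
    by (intro order_trans[OF card_Un_le] add_right_mono card_Un_le)
  also have "card (\<Union>j\<in>{..<N}. B j) \<le> (\<Sum>j<N. card (B j))"
    by (rule card_UN_le) simp
  also have "\<dots> \<le> (\<Sum>j<N. 1)"
    by (intro sum_mono B1)
  also have "card {a, b} \<le> 2"
    by (simp add: card_insert_if)
  finally show ?thesis by simp
qed

lemma marker_at:
  assumes "\<omega> k = a \<and> \<omega> (Suc k) = b" "m < 2 * N"
  shows "w (\<omega> ((k * N + m) div N)) ((k * N + m) mod N) = marker w N a b m"
proof (cases "m < N")
  case True
  then show ?thesis using assms by (simp add: marker_def)
next
  case False
  then have "k * N + m = Suc k * N + (m - N)" "m - N < N" using assms(2) by auto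
  then have "(k * N + m) div N = Suc k" "(k * N + m) mod N = m - N"
    by (simp_all del: mult_Suc)
  then show ?thesis using assms False by (simp add: marker_def)
qed

text \<open>Write \<open>t = i * N + j\<close>. If \<open>j = 0\<close>, the word at
  \<open>i\<close> is close to \<open>a\<close>, hence equal to \<open>a\<close>, which occurs only
  at positions in \<open>A\<close>. If \<open>j > 0\<close>, the whole word at \<open>Suc i\<close>
  lies inside the window, so it is not marker-free and belongs to an inserted marker. That marker
  starts at \<open>Suc i\<close> or at \<open>i\<close>, and matching the window makes the marker
  overlap itself with shift \<open>N - j\<close> or \<open>j\<close>.\<close>

lemma marker_recognition:
  fixes w :: "'b \<Rightarrow> nat \<Rightarrow> 'a::metric_space"
  assumes sep: "separated_words w N S r" and \<eta>: "\<eta> \<le> r" and "N > 0"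
    and ab: "a \<in> S" "b \<in> S" "a \<noteq> b"
    and no: "\<And>J. 1 \<le> J \<Longrightarrow> J < N \<Longrightarrow> \<not> self_overlaps (marker w N a b) (2 * N) J \<eta>"
    and \<omega>: "\<And>k. \<omega> k \<in> S" "\<And>k. k \<in> A \<Longrightarrow> \<omega> k = a \<and> \<omega> (Suc k) = b"
      "\<And>k. \<omega> k \<in> marker_free w N S (marker w N a b) \<eta> - {a, b} \<or> k \<in> A \<or> k \<in> Suc ` A"
    and match: "\<And>m. m < 2 * N \<Longrightarrow> dist (w (\<omega> ((t + m) div N)) ((t + m) mod N)) (marker w N a b m) < \<eta>"
  shows "\<exists>k\<in>A. t = k * N"
proof -
  let ?M = "marker w N a b"
  define i j where "i = t div N" and "j = t mod N"
  have t: "t = i * N + j" "j < N"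
    using \<open>N > 0\<close> by (auto simp: i_def j_def)
  have at: "w (\<omega> ((k * N + m) div N)) ((k * N + m) mod N) = ?M m" if "k \<in> A" "m < 2 * N" for k m
    using marker_at \<omega>(2)[OF that(1)] that(2) by metis
  show ?thesis
  proof (cases "j = 0")
    case True
    have "\<omega> i = a"
    proof (rule separated_wordsD[OF sep \<omega>(1) ab(1)])
      fix m assume "m < N"
      then show "dist (w (\<omega> i) m) (w a m) < r"
        using match[of m] t True \<eta> by (simp add: marker_def)
    qed
    then have "i \<in> A"
      using \<omega>(3)[of i] \<omega>(2) ab(3) by auto
    then show ?thesis using t True by auto
  next
    case False
    have "\<omega> (Suc i) \<notin> marker_free w N S ?M \<eta>"
    proof
      assume "\<omega> (Suc i) \<in> marker_free w N S ?M \<eta>"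
      then obtain l where l: "l < N" "\<eta> \<le> dist (w (\<omega> (Suc i)) l) (?M (N - j + l))"
        using False t(2) unfolding marker_free_def by blast
      define p where "p = N - j + l"
      have p: "p < 2 * N" "t + p = Suc i * N + l"
        using t l(1) False by (auto simp: p_def)
      then have "(t + p) div N = Suc i" "(t + p) mod N = l"
        using l(1) by (simp_all del: mult_Suc)
      then show False
        using match[OF p(1)] l(2) unfolding p_def by simp
    qed
    then consider "Suc i \<in> A" | "i \<in> A"
      using \<omega>(3)[of "Suc i"] by auto
    then show ?thesis
    proof cases
      case 1
      have "self_overlaps ?M (2 * N) (N - j) \<eta>"
        unfolding self_overlaps_def
      proof (intro allI impI)
        fix m assume m: "m < 2 * N - (N - j)"
        have eq: "t + (m + (N - j)) = Suc i * N + m" using t by simp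
        have "w (\<omega> ((t + (m + (N - j))) div N)) ((t + (m + (N - j))) mod N) = ?M m"
          unfolding eq by (rule at[OF 1]) (use m in simp)
        moreover have "m + (N - j) < 2 * N" using m by simp
        ultimately show "dist (?M (m + (N - j))) (?M m) < \<eta>"
          using match by (metis dist_commute)
      qed
      then show ?thesis using no[of "N - j"] False t(2) by auto
    next
      case 2
      have "self_overlaps ?M (2 * N) j \<eta>"
        unfolding self_overlaps_def
      proof (intro allI impI)
        fix m assume m: "m < 2 * N - j"
        have eq: "t + m = i * N + (m + j)" using t by simp
        have "w (\<omega> ((t + m) div N)) ((t + m) mod N) = ?M (m + j)"
          unfolding eq by (rule at[OF 2]) (use m in simp)
        moreover have "m < 2 * N" using m by simp
        ultimately show "dist (?M (m + j)) (?M m) < \<eta>"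
          using match by metis
      qed
      then show ?thesis using no[of j] False t(2) by auto
    qed
  qed
qed

section \<open>Tracing free concatenations\<close>

text \<open>Every concatenation of the orbit words of length \<open>N\<close> starting in \<open>S\<close> is traced with
  precision \<open>\<epsilon>\<close>. The separation \<open>r\<close> of the words must not depend on \<open>\<epsilon>\<close>.\<close>

definition horseshoe ::
  "'a::metric_space set \<Rightarrow> ('a \<Rightarrow> 'a) \<Rightarrow> real \<Rightarrow> real \<Rightarrow> nat \<Rightarrow> 'a set \<Rightarrow> bool" where
  "horseshoe X f r \<epsilon> N S \<longleftrightarrow>
     N > 0 \<and> finite S \<and> S \<subseteq> X \<and> separated_words (\<lambda>x m. (f ^^ m) x) N S r \<and>
     (\<forall>\<omega> :: nat \<Rightarrow> 'a. (\<forall>k. \<omega> k \<in> S) \<longrightarrow>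
        (\<exists>z\<in>X. \<forall>m. dist ((f ^^ m) z) ((f ^^ (m mod N)) (\<omega> (m div N))) < \<epsilon>))"

definition has_horseshoes :: "'a::metric_space set \<Rightarrow> ('a \<Rightarrow> 'a) \<Rightarrow> real \<Rightarrow> real \<Rightarrow> bool" where
  "has_horseshoes X f h r \<longleftrightarrow>
     (\<forall>\<epsilon>>0. \<forall>n0. \<exists>N\<ge>n0. \<exists>S. horseshoe X f r \<epsilon> N S \<and> exp (h * real N) \<le> real (card S))"

text \<open>Concatenated loops form a pseudo-orbit of \<open>f ^^ L\<close>: steps inside a word are
  exact, and the gaps between words are below \<open>\<delta>\<close>. Shadowing traces it at
  multiples of \<open>L\<close>, and uniform continuity fills in the times between. A word of
  \<open>n\<close> steps has length \<open>L * n\<close> for \<open>f\<close>, whence the rate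
  \<open>s / L\<close>.\<close>

lemma shadowing_has_horseshoes:
  fixes X Y :: "'a::metric_space set"
  assumes tds: "topological_dynamical_system X f" and L: "L \<ge> 1"
    and sub: "subsystem X (f ^^ L) Y" and shad: "shadowing_property Y (f ^^ L)"
    and t: "ereal t < bowen_entropy_at X (f ^^ L) Y r" and "0 \<le> s" "s < t" "r > 0"
  shows "has_horseshoes X f (s / real L) (r / 2)"
  unfolding has_horseshoes_def
proof (intro allI impI)
  fix \<epsilon> :: real and n0 :: nat assume "\<epsilon> > 0"
  let ?g = "f ^^ L"
  have Y: "compact Y" "Y \<noteq> {}" "Y \<subseteq> X" "?g ` Y \<subseteq> Y"
    using sub by (auto simp: subsystem_def)
  note gY = funpow_in_invariant[OF Y(4)]
  obtain d where d: "d > 0" "\<And>x y j. x \<in> X \<Longrightarrow> y \<in> X \<Longrightarrow> dist x y < d \<Longrightarrow> j < L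
      \<Longrightarrow> dist ((f ^^ j) x) ((f ^^ j) y) < \<epsilon>"
    using uniform_modulus_iterates[OF tds \<open>\<epsilon> > 0\<close>, of L] by metis
  obtain \<delta> where \<delta>: "\<delta> > 0" "\<And>x. \<forall>i. x i \<in> Y \<Longrightarrow> \<forall>i. dist (?g (x i)) (x (Suc i)) < \<delta>
      \<Longrightarrow> \<exists>z\<in>Y. \<forall>i. dist ((?g ^^ i) z) (x i) < d"
    using shad d(1) unfolding shadowing_property_def by metis
  obtain n S where n: "n \<ge> max n0 1" and S: "finite S" "S \<subseteq> Y" "exp (s * real n) \<le> real (card S)"
    and loop: "\<And>x y. x \<in> S \<Longrightarrow> y \<in> S \<Longrightarrow> dist ((?g ^^ n) x) y < \<delta>"
    and sep: "\<And>x y. x \<in> S \<Longrightarrow> y \<in> S \<Longrightarrow> x \<noteq> y \<Longrightarrow> \<exists>i<n. r / 2 \<le> dist ((?g ^^ i) x) ((?g ^^ i) y)"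
    using many_separated_loops[OF Y t \<open>0 \<le> s\<close> \<open>s < t\<close> \<open>r > 0\<close> \<delta>(1)] by metis
  define N where "N = L * n"
  have "N \<ge> n" using L unfolding N_def by (cases L) auto
  then have N: "N \<ge> n0" "N > 0" using n by auto
  have card: "exp (s / real L * real N) \<le> real (card S)"
    using S(3) L by (simp add: N_def)
  have sepN: "\<exists>m<N. r / 2 \<le> dist ((f ^^ m) x) ((f ^^ m) y)" if xy: "x \<in> S" "y \<in> S" "x \<noteq> y" for x y
  proof -
    obtain i where i: "i < n" "r / 2 \<le> dist ((?g ^^ i) x) ((?g ^^ i) y)"
      using sep[OF xy] by blast
    show ?thesis
      using i L by (intro exI[of _ "L * i"]) (auto simp: N_def funpow_mult)
  qed
  have trace: "\<exists>z\<in>X. \<forall>m. dist ((f ^^ m) z) ((f ^^ (m mod N)) (\<omega> (m div N))) < \<epsilon>"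
    if \<omega>: "\<forall>k. \<omega> k \<in> S" for \<omega>
  proof -
    define x where "x i = (?g ^^ (i mod n)) (\<omega> (i div n))" for i
    have xY: "\<forall>i. x i \<in> Y"
      using \<omega> S(2) gY unfolding x_def by blast
    have "dist (?g (x i)) (x (Suc i)) < \<delta>" for i
    proof (cases "Suc (i mod n) = n")
      case True
      then have "Suc i mod n = 0" "Suc i div n = Suc (i div n)"
        by (auto simp: mod_Suc div_Suc)
      moreover have "?g ((?g ^^ (i mod n)) u) = (?g ^^ n) u" for u
        using True by (metis comp_apply funpow.simps(2))
      ultimately show ?thesis
        using loop \<omega> unfolding x_def by simp
    next
      case False
      then have "Suc i mod n = Suc (i mod n)" "Suc i div n = i div n"
        by (auto simp: mod_Suc div_Suc)
      then show ?thesis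
        using \<delta>(1) unfolding x_def by simp
    qed
    then obtain z where z: "z \<in> Y" "\<And>i. dist ((?g ^^ i) z) (x i) < d"
      using \<delta>(2)[OF xY] by blast
    have "dist ((f ^^ m) z) ((f ^^ (m mod N)) (\<omega> (m div N))) < \<epsilon>" for m
    proof -
      define i j where "i = m div L" and "j = m mod L"
      have ij: "m = j + L * i" "j < L"
        using L by (auto simp: i_def j_def)
      have m: "m div N = i div n" "m mod N = j + L * (i mod n)"
        unfolding N_def i_def j_def by (auto simp: div_mult2_eq mod_mult2_eq)
      have "(f ^^ m) z = (f ^^ j) ((?g ^^ i) z)"
        unfolding ij(1) by (simp add: funpow_add funpow_mult)
      moreover have "(f ^^ (m mod N)) (\<omega> (m div N)) = (f ^^ j) (x i)"
        unfolding m x_def by (simp add: funpow_add funpow_mult)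
      ultimately show ?thesis
        using d(2)[of "(?g ^^ i) z" "x i" j] z gY[OF z(1)] xY Y(3) ij(2) by auto
    qed
    then show ?thesis using z(1) Y(3) by blast
  qed
  have "horseshoe X f (r / 2) \<epsilon> N S"
    using N(2) S(1,2) Y(3) sepN trace unfolding horseshoe_def separated_words_def by simp
  then show "\<exists>N\<ge>n0. \<exists>S. horseshoe X f (r / 2) \<epsilon> N S \<and> exp (s / real L * real N) \<le> real (card S)"
    using N(1) card by blast
qed

section \<open>Correlation with a weight\<close>

text \<open>The function \<open>\<bar>\<theta>\<bar>\<close> is the sum of its \<open>2 * T\<close>
  restrictions to one residue and one sign. If all their averages tended to 0, so would the average
  of \<open>\<bar>\<theta>\<bar>\<close>.\<close>

lemma nontrivial_weight_progression:
  assumes \<theta>: "nontrivial_weight \<theta>" and "T > 0"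
  obtains \<rho> and \<sigma> :: real where "\<rho> < T" "\<bar>\<sigma>\<bar> = 1"
    "limsup (\<lambda>N. ereal (1 / real N * (\<Sum>n<N. if n mod T = \<rho> \<and> \<sigma> * \<theta> n > 0 then \<bar>\<theta> n\<bar> else 0))) > 0"
proof (rule ccontr)
  assume no: "\<not> thesis"
  note found = that
  define F where "F c n = (if n mod T = fst c \<and> snd c * \<theta> n > 0 then \<bar>\<theta> n\<bar> else 0)" for c :: "nat \<times> real" and n
  define I where "I = {..<T} \<times> {1, - 1 :: real}"
  have F0: "F c n \<ge> 0" for c n by (simp add: F_def)
  \<comment> \<open>The terms are nonnegative, so a limsup that is not positive already forces
    convergence to 0.\<close>
  have lim: "(\<lambda>N. 1 / real N * (\<Sum>n<N. F c n)) \<longlonglongrightarrow> 0" if "c \<in> I" for c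
  proof -
    let ?a = "\<lambda>N. ereal (1 / real N * (\<Sum>n<N. F c n))"
    have "\<not> limsup ?a > 0"
      using no found[of "fst c" "snd c"] \<open>c \<in> I\<close> unfolding F_def I_def by auto
    moreover have "0 \<le> liminf ?a"
      by (intro Liminf_bounded always_eventually) (auto simp: F0 sum_nonneg)
    ultimately have "?a \<longlonglongrightarrow> 0"
      using Liminf_le_Limsup[of sequentially ?a]
      by (auto simp: tendsto_iff_Liminf_eq_Limsup)
    then show ?thesis by (simp add: zero_ereal_def)
  qed
  have eq: "\<bar>\<theta> n\<bar> = (\<Sum>c\<in>I. F c n)" for n
  proof -
    have "(\<Sum>c\<in>I. F c n) = (\<Sum>\<rho><T. F (\<rho>, 1) n + F (\<rho>, - 1) n)"
      unfolding I_def by (subst sum.cartesian_product[symmetric, where g = "\<lambda>x y. F (x, y) n", simplified]) simp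
    also have "\<dots> = (\<Sum>\<rho><T. if \<rho> = n mod T then \<bar>\<theta> n\<bar> else 0)"
      by (intro sum.cong) (auto simp: F_def)
    also have "\<dots> = \<bar>\<theta> n\<bar>"
      using \<open>T > 0\<close> by simp
    finally show ?thesis ..
  qed
  have "(\<lambda>N. \<Sum>c\<in>I. 1 / real N * (\<Sum>n<N. F c n)) \<longlonglongrightarrow> (\<Sum>c\<in>I. 0)"
    by (intro tendsto_sum lim)
  moreover have "(\<Sum>c\<in>I. 1 / real N * (\<Sum>n<N. F c n)) = 1 / real N * (\<Sum>n<N. \<bar>\<theta> n\<bar>)" for N
    unfolding eq by (subst sum.swap) (simp add: sum_distrib_left)
  ultimately have "(\<lambda>N. 1 / real N * (\<Sum>n<N. \<bar>\<theta> n\<bar>)) \<longlonglongrightarrow> 0"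
    by simp
  then have "(\<lambda>N. ereal (1 / real N * (\<Sum>n<N. \<bar>\<theta> n\<bar>))) \<longlonglongrightarrow> ereal 0"
    by simp
  then have "limsup (\<lambda>N. ereal (1 / real N * (\<Sum>n<N. \<bar>\<theta> n\<bar>))) = ereal 0"
    by (intro lim_imp_Limsup) auto
  then show False
    using \<theta> by (simp add: nontrivial_weight_def)
qed

text \<open>The mass distribution principle, carried out on sequences. Points of one Bowen ball of
  length \<open>u\<close> share the coordinates in \<open>J u\<close>, so their sequences have
  product measure at most \<open>D * exp (- \<tau> * u)\<close>. A cover of weight below
  \<open>1 / D\<close> would give the whole space measure below 1.\<close>

lemma mass_distribution:
  fixes P :: "'b set" and \<Phi> :: "(nat \<Rightarrow> 'b) \<Rightarrow> 'a::metric_space" and \<tau> D :: real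
  assumes P: "finite P" "P \<noteq> {}" and E: "\<And>v. (\<forall>k. v k \<in> P) \<Longrightarrow> \<Phi> v \<in> E" and "D > 0"
    and J: "\<And>u. finite (J u)" "\<And>u. 1 / real (card P) ^ card (J u) \<le> D * exp (- \<tau> * real u)"
    and ball: "\<And>x u v v' k. \<forall>k. v k \<in> P \<Longrightarrow> \<forall>k. v' k \<in> P \<Longrightarrow> \<Phi> v \<in> bowen_ball X f u x r
      \<Longrightarrow> \<Phi> v' \<in> bowen_ball X f u x r \<Longrightarrow> k \<in> J u \<Longrightarrow> v k = v' k"
    and "0 \<le> t" "t \<le> \<tau>"
  shows "bowen_sum X f E t r \<noteq> 0"
proof
  assume "bowen_sum X f E t r = 0"
  moreover have "ennreal (1 / D) > 0" using \<open>D > 0\<close> by simp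
  ultimately obtain C where C: "C \<in> bowen_covers X f E 0 r"
    and small: "(\<Sum>\<^sub>\<infinity>(x, u)\<in>C. ennreal (exp (- t * real u))) < ennreal (1 / D)"
    unfolding bowen_sum_eq_0_iff by blast
  define M where "M = PiM UNIV (\<lambda>_::nat. uniform_count_measure P)"
  interpret uP: prob_space "uniform_count_measure P"
    using P by (intro prob_space_uniform_count_measure)
  interpret pP: product_prob_space "\<lambda>_::nat. uniform_count_measure P" UNIV
    by standard
  have spM: "space M = {v. \<forall>k. v k \<in> P}"
    by (auto simp: M_def space_PiM space_uniform_count_measure)
  \<comment> \<open>The preimages \<open>H c\<close> of Bowen balls need not be measurable, so they are enlarged to
    cylinders.\<close>
  define H where "H = (\<lambda>(x, u). {v \<in> space M. \<Phi> v \<in> bowen_ball X f u x r})"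
  define cyl where "cyl c = (if H c = {} then {} else
    {v \<in> space M. \<forall>k\<in>J (snd c). v k \<in> {(SOME v. v \<in> H c) k}})" for c
  have Hcyl: "H c \<subseteq> cyl c" for c
  proof
    fix v assume v: "v \<in> H c"
    define v0 where "v0 = (SOME v. v \<in> H c)"
    have v0: "v0 \<in> H c" unfolding v0_def using v by (auto simp: some_in_eq)
    then have "v k = v0 k" if "k \<in> J (snd c)" for k
      using v ball[of v v0 "snd c" "fst c" k] that by (auto simp: H_def spM split: prod.splits)
    then show "v \<in> cyl c"
      using v by (auto simp: cyl_def H_def v0_def split: prod.splits)
  qed
  have cyl: "cyl c \<in> sets M \<and> emeasure M (cyl c) \<le> ennreal (D * exp (- t * real (snd c)))" for c
  proof (cases "H c = {}")
    case False
    define v0 where "v0 = (SOME v. v \<in> H c)"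
    have v0: "v0 \<in> H c" unfolding v0_def using False by (simp add: some_in_eq)
    then have v0P: "v0 k \<in> P" for k by (auto simp: H_def spM split: prod.splits)
    have eq: "cyl c = {v \<in> space M. \<forall>k\<in>J (snd c). v k \<in> {v0 k}}"
      using False by (simp add: cyl_def v0_def)
    have "cyl c \<in> sets M"
      unfolding eq M_def using J(1) v0P
      by (intro sets.sets_Collect_finite_All sets_Collect_single') (auto simp: sets_uniform_count_measure space_uniform_count_measure)
    moreover have "emeasure M (cyl c) = (\<Prod>k\<in>J (snd c). emeasure (uniform_count_measure P) {v0 k})"
      unfolding eq M_def using J(1) v0P
      by (intro pP.emeasure_PiM_Collect) (auto simp: sets_uniform_count_measure)
    moreover have "\<dots> = (\<Prod>k\<in>J (snd c). ennreal (1 / real (card P)))"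
      using v0P P(1) by (intro prod.cong) (auto simp: emeasure_uniform_count_measure)
    moreover have "\<dots> = ennreal (1 / real (card P) ^ card (J (snd c)))"
      by (simp add: ennreal_power power_one_over)
    moreover have "\<dots> \<le> ennreal (D * exp (- t * real (snd c)))"
    proof (intro ennreal_leI order_trans[OF J(2)] mult_left_mono)
      show "exp (- \<tau> * real (snd c)) \<le> exp (- t * real (snd c))"
        using \<open>t \<le> \<tau>\<close> by (simp add: mult_right_mono)
    qed (use \<open>D > 0\<close> in auto)
    ultimately show ?thesis by simp
  qed (simp add: cyl_def)
  have "1 = emeasure M (space M)"
    using pP.P.emeasure_space_1 by (simp add: M_def)
  also have "\<dots> \<le> emeasure M (\<Union>c\<in>C. cyl c)"
  proof (rule emeasure_mono)
    show "space M \<subseteq> (\<Union>c\<in>C. cyl c)"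
    proof
      fix v assume v: "v \<in> space M"
      then have "\<Phi> v \<in> E" using E by (auto simp: spM)
      then obtain c where "c \<in> C" "v \<in> H c"
        using C v unfolding bowen_covers_def H_def by fast
      then show "v \<in> (\<Union>c\<in>C. cyl c)" using Hcyl by blast
    qed
    show "(\<Union>c\<in>C. cyl c) \<in> sets M"
      using C cyl unfolding bowen_covers_def by (intro sets.countable_UN') auto
  qed
  also have "\<dots> \<le> (\<Sum>\<^sub>\<infinity>c\<in>C. emeasure M (cyl c))"
    using C cyl unfolding bowen_covers_def by (intro emeasure_UN_le_infsum) auto
  also have "\<dots> \<le> (\<Sum>\<^sub>\<infinity>c\<in>C. ennreal D * (case c of (x, u) \<Rightarrow> ennreal (exp (- t * real u))))"
    using cyl \<open>D > 0\<close> by (intro infsum_ennreal_mono) (auto simp: ennreal_mult split: prod.splits)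
  also have "\<dots> = ennreal D * (\<Sum>\<^sub>\<infinity>(x, u)\<in>C. ennreal (exp (- t * real u)))"
    unfolding infsum_ennreal_eq_SUP by (simp add: SUP_mult_left_ennreal sum_distrib_left)
  also have "\<dots> < ennreal D * ennreal (1 / D)"
    using small \<open>D > 0\<close> by (intro ennreal_mult_strict_left_mono) auto
  also have "\<dots> = 1"
    using \<open>D > 0\<close> by (simp add: ennreal_mult[symmetric])
  finally show False by simp
qed

text \<open>Recording one symbol in \<open>l0\<close> positions has exponential rate at most
  \<open>c\<close> once \<open>l0\<close> is large compared with \<open>ln K\<close>.\<close>

lemma power_div_le_exp:
  fixes K :: nat and c :: real
  assumes "l0 \<ge> 1" "ln (real K) \<le> c * real l0" "c \<ge> 0"
  shows "real K ^ (N div l0) \<le> exp (c * real N)"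
proof (cases "K = 0")
  case True
  have "(0::real) ^ (N div l0) \<le> 1" by (simp add: power_0_left)
  also have "1 \<le> exp (c * real N)" using assms(3) by simp
  finally show ?thesis using True by simp
next
  case False
  have "real K ^ (N div l0) = exp (real (N div l0) * ln (real K))"
    using False by (simp add: exp_of_nat_mult)
  also have "real (N div l0) * ln (real K) \<le> real (N div l0) * (c * real l0)"
    by (intro mult_left_mono assms(2)) auto
  also have "\<dots> = c * real (N div l0 * l0)"
    by simp
  also have "\<dots> \<le> c * real N"
    using assms(3) by (intro mult_left_mono of_nat_mono) auto
  finally show ?thesis by simp
qed

text \<open>A continuous substitute for the indicator of following \<open>W\<close> for
  \<open>n\<close> steps: a factor is 1 up to distance \<open>\<epsilon>\<close> and 0 from
  \<open>2 * \<epsilon>\<close> on.\<close>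

definition bump :: "('a \<Rightarrow> 'a::metric_space) \<Rightarrow> nat \<Rightarrow> (nat \<Rightarrow> 'a) \<Rightarrow> real \<Rightarrow> 'a \<Rightarrow> real" where
  "bump f n W \<epsilon> x = (\<Prod>m<n. max 0 (min 1 (2 - dist ((f ^^ m) x) (W m) / \<epsilon>)))"

lemma continuous_on_bump:
  assumes "continuous_on X f" "f ` X \<subseteq> X"
  shows "continuous_on X (bump f n W \<epsilon>)"
  unfolding bump_def divide_inverse
  by (intro continuous_intros continuous_on_funpow assms)

lemma bump_eq_1:
  assumes "\<epsilon> > 0" "\<And>m. m < n \<Longrightarrow> dist ((f ^^ m) x) (W m) < \<epsilon>"
  shows "bump f n W \<epsilon> x = 1"
  unfolding bump_def
proof (rule prod.neutral, rule ballI)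
  fix m assume "m \<in> {..<n}"
  then have "dist ((f ^^ m) x) (W m) / \<epsilon> \<le> 1"
    using assms by (simp add: less_imp_le)
  then show "max 0 (min 1 (2 - dist ((f ^^ m) x) (W m) / \<epsilon>)) = 1" by simp
qed

lemma bump_neq_0:
  assumes "\<epsilon> > 0" "bump f n W \<epsilon> x \<noteq> 0" "m < n"
  shows "dist ((f ^^ m) x) (W m) < 2 * \<epsilon>"
proof -
  have "max 0 (min 1 (2 - dist ((f ^^ m) x) (W m) / \<epsilon>)) \<noteq> 0"
    using assms(2,3) unfolding bump_def by auto
  then have "dist ((f ^^ m) x) (W m) / \<epsilon> < 2" by (auto simp: max_def split: if_splits)
  then show ?thesis using assms(1) by (simp add: divide_less_eq)
qed

text \<open>The order of choices is essential: \<open>r\<close> determines the cells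
  \<open>V\<close>, these give \<open>l0\<close> and then \<open>\<epsilon>\<close>, and only then
  is a horseshoe of precision \<open>\<epsilon>\<close> and the same separation \<open>r\<close>
  taken.\<close>

lemma bowen_entropy_correlated_points_ge:
  fixes X :: "'a::metric_space set" and h r \<tau> :: real
  assumes tds: "topological_dynamical_system X f" and hs: "has_horseshoes X f h r"
    and "r > 0" "0 \<le> \<tau>" "\<tau> < h" and \<theta>: "nontrivial_weight \<theta>"
  shows "ereal \<tau> \<le> bowen_entropy X f (correlated_points \<theta> f X)"
proof -
  have X: "compact X" "continuous_on X f" "f ` X \<subseteq> X"
    using tds by (auto simp: topological_dynamical_system_def)
  note fX = funpow_in_invariant[OF X(3)]
  have "h > 0" using assms by linarith
  define w where "w x m = (f ^^ m) x" for x m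
  obtain V cl where V: "finite V" and cl: "\<And>y. y \<in> X \<Longrightarrow> cl y \<in> V" "\<And>y. y \<in> X \<Longrightarrow> dist (cl y) y < r / 8"
    by (rule compact_cells[OF X(1), of "r / 8"]) (use \<open>r > 0\<close> in auto)
  \<comment> \<open>Large enough that the codes of self-overlapping markers grow at rate at most
    \<open>h / 2\<close>, below the rate \<open>h\<close> of the words.\<close>
  define l0 where "l0 = nat \<lceil>2 * ln (real (card V)) / h\<rceil> + 1"
  have l0: "l0 \<ge> 1" "ln (real (card V)) \<le> h / 2 * real l0"
  proof -
    have "2 * ln (real (card V)) / h \<le> real l0" unfolding l0_def by linarith
    then show "ln (real (card V)) \<le> h / 2 * real l0" using \<open>h > 0\<close> by (simp add: field_simps)
  qed (simp add: l0_def)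
  \<comment> \<open>With \<open>\<eta> = 3 * \<epsilon>\<close>, the product
    \<open>2 * \<eta> * l0\<close> is exactly \<open>3 / 4 * r\<close>. The factor 3 adds the radius
    \<open>2 * \<epsilon>\<close> of the bump and the tracing error
    \<open>\<epsilon>\<close>.\<close>
  define \<epsilon> where "\<epsilon> = r / (8 * real l0)"
  define \<eta> where "\<eta> = 3 * \<epsilon>"
  have \<epsilon>: "\<epsilon> > 0" "\<epsilon> \<le> r / 8"
    using \<open>r > 0\<close> l0(1) by (auto simp: \<epsilon>_def field_simps)
  have \<eta>: "\<eta> > 0" "2 * \<eta> * real l0 \<le> 3 / 4 * r" "2 * \<eta> \<le> r" "\<eta> \<le> r"
    using \<epsilon> l0(1) \<open>r > 0\<close> by (auto simp: \<eta>_def) (simp add: \<epsilon>_def)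
  \<comment> \<open>Passing from \<open>h\<close> to \<open>h'\<close> pays for the discarded words;
    passing from \<open>h'\<close> to \<open>\<tau>\<close> pays for the two positions in each
    \<open>q\<close> that are reserved for the marker.\<close>
  define h' where "h' = (\<tau> + h) / 2"
  have h': "\<tau> < h'" "h' < h" "h' > 0" using assms by (auto simp: h'_def)
  define q where "q = nat \<lceil>2 * h' / (h' - \<tau>)\<rceil> + 3"
  have q: "q \<ge> 3" "\<tau> * real q \<le> h' * real (q - 2)"
  proof -
    have "2 * h' / (h' - \<tau>) \<le> real q" unfolding q_def by linarith
    then have "2 * h' \<le> real q * (h' - \<tau>)" using h' by (simp add: field_simps)
    moreover have "real (q - 2) = real q - 2" by (simp add: q_def of_nat_diff)
    ultimately show "\<tau> * real q \<le> h' * real (q - 2)" by (simp add: algebra_simps)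
  qed (simp add: q_def)
  have "\<forall>\<^sub>F N in sequentially. 1 + real N * exp (h / 2 * real N) < exp (h * real N)
      \<and> exp (h' * real N) + real N + 2 \<le> exp (h * real N)"
  proof (intro eventually_conj)
    show "\<forall>\<^sub>F N in sequentially. 1 + real N * exp (h / 2 * real N) < exp (h * real N)"
      using \<open>h > 0\<close> by real_asymp
    show "\<forall>\<^sub>F N in sequentially. exp (h' * real N) + real N + 2 \<le> exp (h * real N)"
      using h' by real_asymp
  qed
  then obtain n0 where n0: "\<And>N. N \<ge> n0 \<Longrightarrow> 1 + real N * exp (h / 2 * real N) < exp (h * real N)"
    "\<And>N. N \<ge> n0 \<Longrightarrow> exp (h' * real N) + real N + 2 \<le> exp (h * real N)"
    unfolding eventually_sequentially by blast
  obtain N S where N: "N \<ge> n0" "N > 0" and S: "finite S" "S \<subseteq> X" "exp (h * real N) \<le> real (card S)"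
    and sep: "separated_words w N S r"
    and trace: "\<And>\<omega>. \<forall>k. \<omega> k \<in> S \<Longrightarrow> \<exists>z\<in>X. \<forall>m. dist (w z m) (w (\<omega> (m div N)) (m mod N)) < \<epsilon>"
  proof -
    obtain N S where "N \<ge> n0" "horseshoe X f r \<epsilon> N S" "exp (h * real N) \<le> real (card S)"
      using hs \<epsilon>(1) unfolding has_horseshoes_def by meson
    then show thesis
      using that[of N S] unfolding horseshoe_def w_def by simp
  qed
  have "S \<noteq> {}" using S(3) by (auto simp: not_le)
  then obtain a where a: "a \<in> S" by blast
  have many: "1 + N * card V ^ (N div l0) < card S"
  proof -
    have "real (1 + N * card V ^ (N div l0)) = 1 + real N * real (card V) ^ (N div l0)" by simp
    also have "\<dots> \<le> 1 + real N * exp (h / 2 * real N)"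
      using power_div_le_exp[OF l0] \<open>h > 0\<close> by (intro add_left_mono mult_left_mono) auto
    also have "\<dots> < real (card S)" using n0(1)[OF N(1)] S(3) by linarith
    finally show ?thesis by (simp only: of_nat_less_iff)
  qed
  obtain b where b: "b \<in> S" "b \<noteq> a"
    and no: "\<And>J. 1 \<le> J \<Longrightarrow> J < N \<Longrightarrow> \<not> self_overlaps (marker w N a b) (2 * N) J \<eta>"
    by (rule exists_marker[OF S(1) sep V _ _ l0(1) \<eta>(2,1) many, of cl a])
      (use cl fX S(2) in \<open>auto simp: w_def subset_iff\<close>)
  define M where "M = marker w N a b"
  define P where "P = marker_free w N S M \<eta> - {a, b}"
  have PS: "P \<subseteq> S" by (auto simp: P_def marker_free_def)
  have finP: "finite P" using PS S(1) finite_subset by blast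
  have cardP: "exp (h' * real N) \<le> real (card P)"
    using card_marker_free[OF S(1) sep \<eta>(3), of M a b] n0(2)[OF N(1)] S(3) unfolding P_def by linarith
  have "P \<noteq> {}" using cardP by (auto simp: not_le)
  define T where "T = q * N"
  have T: "T > 0" using q(1) N(2) by (simp add: T_def)
  obtain \<rho> and \<sigma> :: real where \<rho>: "\<rho> < T" and \<sigma>: "\<bar>\<sigma>\<bar> = 1"
    and lim: "limsup (\<lambda>N. ereal (1 / real N * (\<Sum>n<N. if n mod T = \<rho> \<and> \<sigma> * \<theta> n > 0 then \<bar>\<theta> n\<bar> else 0))) > 0"
    using nontrivial_weight_progression[OF \<theta> T] by blast
  \<comment> \<open>A superblock has \<open>q\<close> words; marker number \<open>k\<close> sits at the front of superblock \<open>Suc k\<close>, and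
    passing to the point of time \<open>T - \<rho>\<close> of the traced orbit aligns it with the weight at
    \<open>k * T + \<rho>\<close>.\<close>
  define A where "A = {p. \<exists>k. p = Suc k * q \<and> \<sigma> * \<theta> (k * T + \<rho>) > 0}"
  have A0: "p mod q = 0" if "p \<in> A" for p
    using that by (auto simp: A_def simp del: mult_Suc)
  have A1: "p mod q = 1" if "p \<in> Suc ` A" for p
    using that A0 q(1) by (auto simp: mod_Suc)
  define \<omega> where "\<omega> v p = (if p \<in> A then a else if p \<in> Suc ` A then b else v p)" for v :: "nat \<Rightarrow> 'a" and p
  have \<omega>S: "\<omega> v k \<in> S" if "\<forall>k. v k \<in> P" for v k
    using that PS a b(1) by (auto simp: \<omega>_def)
  have \<omega>A: "\<omega> v k = a \<and> \<omega> v (Suc k) = b" if "k \<in> A" for v k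
  proof -
    have "Suc k \<notin> A" using A0[of "Suc k"] A1[of "Suc k"] that by auto
    then show ?thesis using that by (auto simp: \<omega>_def)
  qed
  have \<omega>P: "\<omega> v k \<in> P \<or> k \<in> A \<or> k \<in> Suc ` A" if "\<forall>k. v k \<in> P" for v k
    using that by (auto simp: \<omega>_def)
  define z where "z v = (SOME z. z \<in> X \<and> (\<forall>m. dist (w z m) (w (\<omega> v (m div N)) (m mod N)) < \<epsilon>))" for v
  have z: "z v \<in> X" "\<And>m. dist (w (z v) m) (w (\<omega> v (m div N)) (m mod N)) < \<epsilon>" if "\<forall>k. v k \<in> P" for v
  proof -
    have "\<exists>z. z \<in> X \<and> (\<forall>m. dist (w z m) (w (\<omega> v (m div N)) (m mod N)) < \<epsilon>)"
      using trace[of "\<omega> v"] \<omega>S[OF that] by blast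
    from someI_ex[OF this] show "z v \<in> X" "\<And>m. dist (w (z v) m) (w (\<omega> v (m div N)) (m mod N)) < \<epsilon>"
      unfolding z_def[symmetric] by blast+
  qed
  define \<Phi> where "\<Phi> v = (f ^^ (T - \<rho>)) (z v)" for v
  have \<Phi>: "(f ^^ n) (\<Phi> v) = w (z v) (n + (T - \<rho>))" for n v
    by (simp add: \<Phi>_def w_def funpow_add)
  have corr: "\<Phi> v \<in> correlated_points \<theta> f X" if v: "\<forall>k. v k \<in> P" for v
  proof -
    define \<phi> where "\<phi> = bump f (2 * N) M \<epsilon>"
    have cont: "continuous_on X \<phi>" unfolding \<phi>_def by (intro continuous_on_bump X)
    \<comment> \<open>The bump takes only the values 0 and 1 along this orbit: a nonzero value means
      a match within \<open>\<eta>\<close>, which recognition allows only at inserted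
      markers.\<close>
    have val: "\<phi> ((f ^^ n) (\<Phi> v)) = (if n mod T = \<rho> \<and> \<sigma> * \<theta> n > 0 then 1 else 0)" for n
    proof -
      define t where "t = n + (T - \<rho>)"
      have orb: "(f ^^ m) ((f ^^ n) (\<Phi> v)) = w (z v) (t + m)" for m
        unfolding \<Phi> by (simp add: w_def t_def add.commute[of _ m] funpow_add)
      show ?thesis
      proof (cases "n mod T = \<rho> \<and> \<sigma> * \<theta> n > 0")
        case True
        define k where "k = n div T"
        have n: "n = k * T + \<rho>" using True by (metis k_def div_mult_mod_eq)
        have kA: "Suc k * q \<in> A" using True n by (auto simp: A_def)
        have t: "t = Suc k * q * N" using n \<rho> by (simp add: t_def T_def algebra_simps)
        have "dist ((f ^^ m) ((f ^^ n) (\<Phi> v))) (M m) < \<epsilon>" if "m < 2 * N" for m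
          using z(2)[OF v, of "t + m"] marker_at[OF \<omega>A[OF kA, of v] that, of w]
          unfolding orb M_def t by simp
        then have "\<phi> ((f ^^ n) (\<Phi> v)) = 1"
          unfolding \<phi>_def by (intro bump_eq_1 \<epsilon>(1))
        then show ?thesis using True by simp
      next
        case False
        have "\<phi> ((f ^^ n) (\<Phi> v)) = 0"
        proof (rule ccontr)
          assume nz: "\<phi> ((f ^^ n) (\<Phi> v)) \<noteq> 0"
          have "dist (w (\<omega> v ((t + m) div N)) ((t + m) mod N)) (marker w N a b m) < \<eta>" if m: "m < 2 * N" for m
          proof -
            have "dist (w (z v) (t + m)) (M m) < 2 * \<epsilon>"
              using bump_neq_0[OF \<epsilon>(1) nz[unfolded \<phi>_def] m] unfolding orb .
            then show ?thesis
              using z(2)[OF v, of "t + m"]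
                dist_triangle3[of "w (\<omega> v ((t + m) div N)) ((t + m) mod N)" "M m" "w (z v) (t + m)"]
              unfolding \<eta>_def M_def by linarith
          qed
          then have "\<exists>p\<in>A. t = p * N"
            using marker_recognition[OF sep \<eta>(4) N(2) a b(1) b(2)[symmetric] no, of "\<omega> v" A t]
              \<omega>S[OF v] \<omega>A \<omega>P[OF v] unfolding P_def M_def by blast
          then obtain k where k: "t = Suc k * q * N" "\<sigma> * \<theta> (k * T + \<rho>) > 0"
            by (auto simp: A_def)
          then have "n = k * T + \<rho>"
            using \<rho> by (simp add: t_def T_def algebra_simps)
          then show False using False k(2) \<rho> by simp
        qed
        then show ?thesis using False by simp
      qed
    qed
    \<comment> \<open>All nonzero terms have the sign \<open>\<sigma>\<close>, so no cancellation
      occurs in the weighted sum.\<close>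
    have "\<theta> n * \<phi> ((f ^^ n) (\<Phi> v)) = \<sigma> * (if n mod T = \<rho> \<and> \<sigma> * \<theta> n > 0 then \<bar>\<theta> n\<bar> else 0)" for n
      using \<sigma> unfolding val by (auto simp: abs_if zero_less_mult_iff split: if_splits)
    then have "\<bar>\<Sum>n<N'. \<theta> n * \<phi> ((f ^^ n) (\<Phi> v))\<bar>
        = (\<Sum>n<N'. if n mod T = \<rho> \<and> \<sigma> * \<theta> n > 0 then \<bar>\<theta> n\<bar> else 0)" for N'
      using \<sigma> by (simp add: sum_distrib_left[symmetric] abs_mult sum_nonneg)
    then have "limsup (\<lambda>N. ereal (1 / real N * \<bar>\<Sum>n<N. \<theta> n * \<phi> ((f ^^ n) (\<Phi> v))\<bar>)) > 0"
      using lim by simp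
    moreover have "\<Phi> v \<in> X" unfolding \<Phi>_def using fX z(1)[OF v] by blast
    ultimately show ?thesis using cont unfolding correlated_points_def by blast
  qed
  \<comment> \<open>The free positions in the superblocks that are completely visible up to time \<open>u\<close>.\<close>
  define J where "J u = {p. q \<le> p \<and> p < q * (u div T) \<and> 2 \<le> p mod q}" for u
  \<comment> \<open>Two superblocks contribute no free positions to \<open>J u\<close>: the first,
    whose beginning is cut off by the shift \<open>T - \<rho>\<close>, and the last, incomplete one.
    \<open>D\<close> absorbs both.\<close>
  define D where "D = exp (2 * h' * real N * real (q - 2))"
  have finJ: "finite (J u)" for u unfolding J_def by (rule finite_subset[of _ "{..<q * (u div T)}"]) auto
  have cardJ: "(u div T - 1) * (q - 2) \<le> card (J u)" for u
  proof -
    have "inj_on (\<lambda>(k, i). k * q + i) ({1..<u div T} \<times> {2..<q})"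
    proof (rule inj_onI, clarify)
      fix k i k' i' assume i: "i \<in> {2..<q}" "i' \<in> {2..<q}" and eq: "k * q + i = k' * q + i'"
      have "(k * q + i) div q = k" "(k * q + i) mod q = i" "(k' * q + i') div q = k'" "(k' * q + i') mod q = i'"
        using i by auto
      then show "k = k' \<and> i = i'" using eq by metis
    qed
    moreover have "(\<lambda>(k, i). k * q + i) ` ({1..<u div T} \<times> {2..<q}) \<subseteq> J u"
    proof clarify
      fix k i assume k: "k \<in> {1..<u div T}" and i: "i \<in> {2..<q}"
      have "k * q + i < Suc k * q" using i by simp
      also have "\<dots> \<le> u div T * q" using k by (intro mult_le_mono1) auto
      finally have "k * q + i < q * (u div T)" by (simp add: mult.commute)
      moreover have "q \<le> k * q + i" using k by (cases k) auto
      ultimately show "k * q + i \<in> J u" using i by (simp add: J_def)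
    qed
    ultimately have "card ({1..<u div T} \<times> {2..<q}) \<le> card (J u)"
      using finJ by (rule card_inj_on_le)
    then show ?thesis by (simp add: card_cartesian_product)
  qed
  have massJ: "1 / real (card P) ^ card (J u) \<le> D * exp (- \<tau> * real u)" for u
  proof -
    have "exp (h' * real N * real (card (J u))) \<le> real (card P) ^ card (J u)"
      using power_mono[OF cardP, of "card (J u)"] by (simp add: exp_of_nat2_mult[symmetric])
    then have "1 / real (card P) ^ card (J u) \<le> 1 / exp (h' * real N * real (card (J u)))"
      using finP \<open>P \<noteq> {}\<close> by (intro divide_left_mono) (auto simp: card_gt_0_iff)
    also have "\<dots> = exp (- (h' * real N * real (card (J u))))"
      by (simp add: exp_minus inverse_eq_divide)
    also have "\<dots> \<le> exp (2 * h' * real N * real (q - 2) - \<tau> * real u)"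
    proof -
      have "u < T * (u div T) + T" using T by (metis add_strict_left_mono mod_less_divisor mult_div_mod_eq)
      then have "u \<le> T * ((u div T - 1) + 2)" by (cases "u div T") (auto simp: algebra_simps)
      then have "real u \<le> real T * (real (u div T - 1) + 2)"
        by (metis (mono_tags) of_nat_add of_nat_le_iff of_nat_mult of_nat_numeral)
      then have "\<tau> * real u \<le> \<tau> * (real T * (real (u div T - 1) + 2))"
        using \<open>0 \<le> \<tau>\<close> by (rule mult_left_mono)
      also have "\<dots> = (\<tau> * real q) * (real N * (real (u div T - 1) + 2))"
        by (simp add: T_def)
      also have "\<dots> \<le> (h' * real (q - 2)) * (real N * (real (u div T - 1) + 2))"
        using q(2) by (rule mult_right_mono) auto
      also have "\<dots> = h' * real N * real ((u div T - 1) * (q - 2)) + 2 * h' * real N * real (q - 2)"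
        unfolding of_nat_mult by algebra
      also have "h' * real N * real ((u div T - 1) * (q - 2)) \<le> h' * real N * real (card (J u))"
        using cardJ h'(3) by (intro mult_left_mono of_nat_mono) auto
      finally show ?thesis by simp
    qed
    also have "\<dots> = D * exp (- \<tau> * real u)"
      by (simp add: D_def exp_diff exp_minus field_simps)
    finally show ?thesis .
  qed
  \<comment> \<open>Both words at \<open>p\<close> are within \<open>\<epsilon> + r / 4\<close>, at
    most \<open>3 / 8 * r\<close>, of the orbit of the centre \<open>x\<close>, hence closer than
    \<open>r\<close> to each other.\<close>
  have rigid: "v p = v' p"
    if v: "\<forall>k. v k \<in> P" "\<forall>k. v' k \<in> P" and ball: "\<Phi> v \<in> bowen_ball X f u x (r / 4)" "\<Phi> v' \<in> bowen_ball X f u x (r / 4)"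
      and p: "p \<in> J u" for x u v v' p
  proof (rule separated_wordsD[OF sep])
    show "v p \<in> S" "v' p \<in> S" using v PS by auto
    fix m assume m: "m < N"
    define i where "i = p * N + m - (T - \<rho>)"
    \<comment> \<open>Skipping the first superblock makes the natural subtraction in
      \<open>i\<close> exact.\<close>
    have "T \<le> p * N" using p unfolding J_def T_def by simp
    then have i: "i + (T - \<rho>) = p * N + m" by (simp add: i_def)
    have "p * N + m < Suc p * N" using m by simp
    also have "\<dots> \<le> q * (u div T) * N" using p by (intro mult_le_mono1) (auto simp: J_def)
    also have "\<dots> = T * (u div T)" by (simp add: T_def)
    also have "\<dots> \<le> u" by simp
    finally have "i < u" by (simp add: i_def)
    have near: "dist (w (c p) m) ((f ^^ i) x) < r / 8 + r / 4"
      if c: "\<forall>k. c k \<in> P" "\<Phi> c \<in> bowen_ball X f u x (r / 4)" for c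
    proof -
      have "p \<notin> A" "p \<notin> Suc ` A" using p A0[of p] A1[of p] by (auto simp: J_def)
      then have "\<omega> c p = c p" by (simp add: \<omega>_def)
      then have "dist (w (z c) (p * N + m)) (w (c p) m) < \<epsilon>"
        using z(2)[OF c(1), of "p * N + m"] m by simp
      moreover have "dist ((f ^^ i) x) (w (z c) (p * N + m)) < r / 4"
      proof -
        have "(f ^^ i) (\<Phi> c) = w (z c) (p * N + m)"
          unfolding \<Phi> i ..
        then show ?thesis
          using c(2) \<open>i < u\<close> unfolding bowen_ball_def by auto
      qed
      ultimately show ?thesis
        using \<epsilon>(2) dist_triangle[of "w (c p) m" "(f ^^ i) x" "w (z c) (p * N + m)"]
        by (simp add: dist_commute)
    qed
    show "dist (w (v p) m) (w (v' p) m) < r"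
      using near[OF v(1) ball(1)] near[OF v(2) ball(2)] \<open>r > 0\<close>
        dist_triangle2[of "w (v p) m" "w (v' p) m" "(f ^^ i) x"] by linarith
  qed
  show ?thesis
  proof (rule bowen_entropy_ge[of "r / 4"])
    fix t assume t: "0 \<le> t" "t < \<tau>"
    show "bowen_sum X f (correlated_points \<theta> f X) t (r / 4) \<noteq> 0"
    proof (rule mass_distribution[where P = P and \<Phi> = \<Phi> and J = J and D = D and \<tau> = \<tau>])
      show "finite P" "P \<noteq> {}" "D > 0" "0 \<le> t" "t \<le> \<tau>"
        using finP \<open>P \<noteq> {}\<close> t by (auto simp: D_def)
      show "\<Phi> v \<in> correlated_points \<theta> f X" if "\<forall>k. v k \<in> P" for v
        using that by (rule corr)
      show "finite (J u)" "1 / real (card P) ^ card (J u) \<le> D * exp (- \<tau> * real u)" for u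
        by (rule finJ, rule massJ)
    qed (rule rigid)
  qed (use \<open>r > 0\<close> in simp)
qed

section \<open>Comparison of the three entropies\<close>

theorem theoremB:
  fixes X Y :: "'a::metric_space set" and f :: "'a \<Rightarrow> 'a" and L :: nat
  assumes "topological_dynamical_system X f"
    and "L \<ge> 1"
    and "subsystem X (f ^^ L) Y"
    and "shadowing_property Y (f ^^ L)"
    and "bowen_entropy X (f ^^ L) Y > 0"
    and "X = (\<Union>i\<in>{0..L-1}. (f ^^ i) ` Y)"
  shows "(\<forall>\<theta>. nontrivial_weight \<theta> \<longrightarrow>
            bowen_entropy X f (correlated_points \<theta> f X) = bowen_entropy X f X \<and>
            bowen_entropy X f X = ereal (1 / real L) * bowen_entropy X (f ^^ L) Y \<and>
            ereal (1 / real L) * bowen_entropy X (f ^^ L) Y > 0) \<and>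
         bohr_chaotic X f"
proof -
  let ?H = "bowen_entropy X (f ^^ L) Y"
  have pos: "0 < ereal (1 / real L) * ?H"
    using assms(2,5) by (cases ?H) auto
  have lower: "ereal (1 / real L) * ?H \<le> bowen_entropy X f (correlated_points \<theta> f X)"
    if \<theta>: "nontrivial_weight \<theta>" for \<theta>
  proof (rule dense_le)
    fix y assume y: "y < ereal (1 / real L) * ?H"
    \<comment> \<open>The maximum with 0 gives a real nonnegative rate even when \<open>y\<close> is
      negative or minus infinity.\<close>
    then have "max 0 y < ereal (1 / real L) * ?H" using pos by simp
    then obtain \<tau> where \<tau>: "max 0 y = ereal \<tau>" "ereal \<tau> < ereal (1 / real L) * ?H"
      by (cases "max 0 y") (auto simp: max_def split: if_splits)
    then have "0 \<le> \<tau>" by (metis ereal_less_eq(5) max.cobounded1)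
    have "ereal (\<tau> * real L) < ?H"
      using \<tau>(2) assms(2) by (cases ?H) (auto simp: field_simps)
    then obtain t where t: "ereal (\<tau> * real L) < ereal t" "ereal t < ?H"
      using ereal_dense2 by blast
    then obtain r where r: "r > 0" "ereal t < bowen_entropy_at X (f ^^ L) Y r"
      unfolding bowen_entropy_eq_SUP by (auto simp: less_SUP_iff)
    \<comment> \<open>The midpoint leaves room on both sides: \<open>s < t\<close> for extracting
      loops, and \<open>\<tau> < s / L\<close> for the losses in the marker construction.\<close>
    define s where "s = (\<tau> * real L + t) / 2"
    have s: "0 \<le> s" "s < t" "\<tau> < s / real L"
    proof -
      have "0 \<le> \<tau> * real L" using \<open>0 \<le> \<tau>\<close> by simp
      then show "0 \<le> s" "s < t" "\<tau> < s / real L"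
        using t(1) assms(2) by (auto simp: s_def field_simps)
    qed
    have "ereal \<tau> \<le> bowen_entropy X f (correlated_points \<theta> f X)"
    proof (rule bowen_entropy_correlated_points_ge[OF assms(1)])
      show "has_horseshoes X f (s / real L) (r / 2)"
        by (rule shadowing_has_horseshoes[OF assms(1-4) r(2) s(1,2) r(1)])
    qed (use r(1) \<open>0 \<le> \<tau>\<close> s(3) \<theta> in auto)
    then show "y \<le> bowen_entropy X f (correlated_points \<theta> f X)"
      unfolding \<tau>(1)[symmetric] by simp
  qed
  have "Y \<subseteq> X" using assms(3) by (simp add: subsystem_def)
  then have upper: "bowen_entropy X f X \<le> ereal (1 / real L) * ?H"
    by (rule bowen_entropy_power_le[OF assms(1,2,6)])
  have mono: "bowen_entropy X f (correlated_points \<theta> f X) \<le> bowen_entropy X f X" for \<theta>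
    by (intro bowen_entropy_mono) (auto simp: correlated_points_def)
  have "correlated_points \<theta> f X \<noteq> {}" if "nontrivial_weight \<theta>" for \<theta>
    using lower[OF that] pos bowen_entropy_empty[of X f] by auto
  then have "bohr_chaotic X f" by (simp add: bohr_chaotic_def)
  moreover have "bowen_entropy X f (correlated_points \<theta> f X) = bowen_entropy X f X \<and>
      bowen_entropy X f X = ereal (1 / real L) * ?H" if "nontrivial_weight \<theta>" for \<theta>
    using lower[OF that] upper mono[of \<theta>] by (meson order_antisym order_trans)
  ultimately show ?thesis using pos by blast
qed

end
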